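(* Let $\mathscr{V}$ be a topological category over $\mathsf{Set}$, with topological functor $|-| : \mathscr{V} \to \mathsf{Set}$, equipped with a symmetric monoidal structure $(\otimes, I)$ such that $|-|$ is strict symmetric monoidal with respect to the cartesian structure on $\mathsf{Set}$, and let $\mathcal{S}$ be a set. A $\mathscr{V}$-enriched $\mathcal{S}$-sorted equational theory is equivalently given by a $\mathscr{V}$-enriched $\mathcal{S}$-sorted signature $\Sigma$ and a classical $\mathcal{S}$-sorted equational theory over the underlying classical $\mathcal{S}$-sorted signature $|\Sigma|$. More precisely: 1. Given a $\mathscr{V}$-enriched $\mathcal{S}$-sorted equational theory $\mathcal{T} = (\Sigma, \mathcal{E})$, there is a classical $\mathcal{S}$-sorted equational theory $|\mathcal{T}| = (|\Sigma|, |\mathcal{E}|)$ over $|\Sigma|$ such that a $\Sigma$-algebra $A$ is a $\mathcal{T}$-algebra iff the underlying $|\Sigma|$-algebra $|A|$ is a $|\mathcal{T}|$-algebra. 2. Conversely, given a $\mathscr{V}$-enriched $\mathcal{S}$-sorted signature $\Sigma$ and a classical $\mathcal{S}$-sorted equational theory $\mathcal{T} = (|\Sigma|, \mathcal{E})$ over $|\Sigma|$, there is a $\mathscr{V}$-enriched $\mathcal{S}$-sorted equational theory $\widehat{\mathcal{T}} = (\Sigma, \widehat{\mathcal{E}})$ over $\Sigma$ such that a $\Sigma$-algebra $A$ is a $\widehat{\mathcal{T}}$-algebra iff the underlying $|\Sigma|$-algebra $|A|$ is a $\mathcal{T}$-algebra.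
   Context: Topological categories. A concrete category over $\mathsf{Set}$ is a category $\mathscr{V}$ with a faithful functor $|-| : \mathscr{V} \to \mathsf{Set}$; a function $f : |V| \to |W|$ is admissible if it lifts (uniquely) to a morphism $V \to W$. It is amnestic if, whenever $|V| = |V'|$ and the identity function is admissible both $V \to V'$ and $V' \to V$, then $V = V'$. A (possibly large) source $(f_i : V \to V_i)_{i}$ is initial if for all $W$ and $f : |W| \to |V|$, $f$ is admissible iff all $f_i \circ f$ are. $\mathscr{V}$ is topological over $\mathsf{Set}$ if it is amnestic and every (possibly large) structured source $(f_i : X \to |V_i|)_i$ has an initial lift: an object $V$ with $|V| = X$, each $f_i$ admissible $V \to V_i$, and $(f_i : V \to V_i)_i$ initial. One has $|X \otimes Y| = |X| \times |Y|$, $|X \times Y| = |X| \times |Y|$, and $|I|$ is a singleton. Signatures. $\mathcal{S}^*$ is the set of finite sequences of elements (sorts) of $\mathcal{S}$. A $\mathscr{V}$-enriched $\mathcal{S}$-sorted signature is a set $\Sigma$ of operation symbols, each equipped with a type $((S_1, \ldots, S_n), S, P)$: input sorts $(S_1,\ldots,S_n) \in \mathcal{S}^*$, output sort $S \in \mathcal{S}$, parameter object $P \in \mathrm{ob}\,\mathscr{V}$. A $\Sigma$-algebra is an object $A = (A_S)_{S}$ of $\mathscr{V}^{\mathcal{S}}$ with, for each $\sigma \in \Sigma$ of type $((S_1, \ldots, S_n), S, P)$, a $\mathscr{V}$-morphism $\sigma^A : P \otimes (A_{S_1} \times \cdots \times A_{S_n}) \to A_S$. A morphism $f : A \to B$ of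 $\Sigma$-algebras is a morphism of $\mathscr{V}^{\mathcal{S}}$ with $f_S \circ \sigma^A = \sigma^B \circ (1_P \otimes (f_{S_1} \times \cdots \times f_{S_n}))$ for all $\sigma$. These form a category $\Sigma\text{-}\mathsf{Alg}$. A classical $\mathcal{S}$-sorted signature is the case $\mathscr{V} = \mathsf{Set}$ (cartesian) with all parameters equal to the one-point set (omitted from notation). Underlying classical signature. $|\Sigma|$ has an operation symbol $\sigma_p$ with input sorts $(S_1,\ldots,S_n)$ and output sort $S$ for each $\sigma \in \Sigma$ of type $((S_1,\ldots,S_n),S,P)$ and each $p \in |P|$. Each $\Sigma$-algebra $A$ has an underlying $|\Sigma|$-algebra $|A|$ with carrier $(|A_S|)_S$ and $\sigma_p^{|A|} = \sigma^A(p, -)$. Enriched theories. For $P \in \mathrm{ob}\,\mathscr{V}$ and $\overline{S} = (S_1, \ldots, S_n) \in \mathcal{S}^*$, let $P \otimes U^{\overline{S}} : \Sigma\text{-}\mathsf{Alg} \to \mathscr{V}$ be the functor $A \mapsto P \otimes (A_{S_1} \times \cdots \times A_{S_n})$, and let $U^S : \Sigma\text{-}\mathsf{Alg} \to \mathscr{V}$ be $A \mapsto A_S$. An algebraic $\Sigma$-operation of type $(\overline{S}, S, P)$ is a natural transformation $\omega : P \otimes U^{\overline{S}} \Rightarrow U^S$. An algebraic $\Sigma$-equation $\omega \doteq \nu$ is a pair of algebraic $\Sigma$-operations of the same type; a $\Sigma$-algebra $A$ satisfies it if $\omega_A = \nu_A$. A $\mathscr{V}$-enriched $\mathcal{S}$-sorted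 equational theory (over $\Sigma$) is a pair $\mathcal{T} = (\Sigma, \mathcal{E})$ with $\Sigma$ a $\mathscr{V}$-enriched $\mathcal{S}$-sorted signature and $\mathcal{E}$ a set of algebraic $\Sigma$-equations; a $\mathcal{T}$-algebra is a $\Sigma$-algebra satisfying all equations in $\mathcal{E}$. Classical theories. Let $\Sigma$ be a classical $\mathcal{S}$-sorted signature and fix pairwise disjoint countably infinite sets of variables $\mathsf{Var}_S$ ($S \in \mathcal{S}$). A context $\overline{v}$ is a finite (possibly empty) list $v_1 : S_1, \ldots, v_n : S_n$ of pairwise distinct sorted variables ($v_i \in \mathsf{Var}_{S_i}$). Terms in context $\overline{v}$: each $[\overline{v} \vdash v_i : S_i]$ is a term of sort $S_i$; if $\sigma \in \Sigma$ has input sorts $T_1, \ldots, T_m$ and output sort $T$ and $[\overline{v} \vdash t_j : T_j]$ are terms, then $[\overline{v} \vdash \sigma(t_1, \ldots, t_m) : T]$ is a term of sort $T$. In a $\Sigma$-algebra $A$, a term $[\overline{v} \vdash t : S]$ is interpreted recursively as a function $[\overline{v} \vdash t : S]^A : A_{S_1} \times \cdots \times A_{S_n} \to A_S$ (variables $v_i$ as projections onto the $i$-th factor; $\sigma(t_1, \ldots, t_m)$ as $\sigma^A$ composed with the tuple of interpretations). A syntactic $\Sigma$-equation $[\overline{v} \vdash s \doteq t : S]$ in context is a pair of terms of the same sort in the same context; $A$ satisfies it if the two interpretations coincide. A classical $\mathcal{S}$-sorted equational theory over $\Sigma$ is a pair $(\Sigma, \mathcal{E})$ with $\mathcal{E}$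 a set of syntactic $\Sigma$-equations in context; its algebras are the $\Sigma$-algebras satisfying every equation in $\mathcal{E}$. *)

theory Defs
  imports "HOL-Library.FuncSet"
begin

record ('o, 'm) cat =
  Ob :: "'o set"
  Arr :: "'m set"
  Dom :: "'m \<Rightarrow> 'o"
  Cod :: "'m \<Rightarrow> 'o"
  Idn :: "'o \<Rightarrow> 'm"
  Cmp :: "'m \<Rightarrow> 'm \<Rightarrow> 'm" (infixr "\<cdot>\<index>" 65)

definition hom :: "('o, 'm, 'z) cat_scheme \<Rightarrow> 'o \<Rightarrow> 'o \<Rightarrow> 'm set" where
  "hom C X Y = {f \<in> Arr C. Dom C f = X \<and> Cod C f = Y}"

locale category =
  fixes C :: "('o, 'm, 'z) cat_scheme" (structure)
  assumes dom_ob: "f \<in> Arr C \<Longrightarrow> Dom C f \<in> Ob C"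
    and cod_ob: "f \<in> Arr C \<Longrightarrow> Cod C f \<in> Ob C"
    and id_hom: "X \<in> Ob C \<Longrightarrow> Idn C X \<in> hom C X X"
    and comp_hom: "f \<in> hom C X Y \<Longrightarrow> g \<in> hom C Y Z \<Longrightarrow> g \<cdot> f \<in> hom C X Z"
    and comp_assoc: "f \<in> hom C W X \<Longrightarrow> g \<in> hom C X Y \<Longrightarrow> h \<in> hom C Y Z \<Longrightarrow>
          (h \<cdot> g) \<cdot> f = h \<cdot> (g \<cdot> f)"
    and comp_id_left: "f \<in> hom C X Y \<Longrightarrow> Idn C Y \<cdot> f = f"
    and comp_id_right: "f \<in> hom C X Y \<Longrightarrow> f \<cdot> Idn C X = f"

definition iso_arr :: "('o, 'm, 'z) cat_scheme \<Rightarrow> 'o \<Rightarrow> 'o \<Rightarrow> 'm \<Rightarrow> bool" where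
  "iso_arr C X Y f \<longleftrightarrow> f \<in> hom C X Y \<and>
     (\<exists>g \<in> hom C Y X. Cmp C g f = Idn C X \<and> Cmp C f g = Idn C Y)"

record ('o, 'm, 'p, 'n) fctr =
  FO :: "'o \<Rightarrow> 'p"
  FA :: "'m \<Rightarrow> 'n"

locale cat_functor = C: category C + D: category D
  for C :: "('o, 'm, 'y) cat_scheme" and D :: "('p, 'n, 'z) cat_scheme" +
  fixes F :: "('o, 'm, 'p, 'n) fctr"
  assumes fun_ob: "X \<in> Ob C \<Longrightarrow> FO F X \<in> Ob D"
    and fun_hom: "f \<in> hom C X Y \<Longrightarrow> FA F f \<in> hom D (FO F X) (FO F Y)"
    and fun_id: "X \<in> Ob C \<Longrightarrow> FA F (Idn C X) = Idn D (FO F X)"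
    and fun_comp: "f \<in> hom C X Y \<Longrightarrow> g \<in> hom C Y Z \<Longrightarrow>
          FA F (Cmp C g f) = Cmp D (FA F g) (FA F f)"

text \<open>Components are extensional, so that equality of natural transformations is equality in HOL.\<close>

locale nat_trans = F: cat_functor C D F + G: cat_functor C D G
  for C :: "('o, 'm, 'y) cat_scheme" and D :: "('p, 'n, 'z) cat_scheme"
    and F G :: "('o, 'm, 'p, 'n) fctr" +
  fixes \<eta> :: "'o \<Rightarrow> 'n"
  assumes component: "X \<in> Ob C \<Longrightarrow> \<eta> X \<in> hom D (FO F X) (FO G X)"
    and naturality: "f \<in> hom C X Y \<Longrightarrow> Cmp D (FA G f) (\<eta> X) = Cmp D (\<eta> Y) (FA F f)"
    and ext: "\<eta> \<in> extensional (Ob C)"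

record ('o, 'm) smcat = "('o, 'm) cat" +
  tenO :: "'o \<Rightarrow> 'o \<Rightarrow> 'o" (infixr "\<otimes>\<index>" 75)
  tenA :: "'m \<Rightarrow> 'm \<Rightarrow> 'm" (infixr "\<boxtimes>\<index>" 75)
  unitO :: 'o ("\<one>\<index>")
  assoc :: "'o \<Rightarrow> 'o \<Rightarrow> 'o \<Rightarrow> 'm"
  lunit :: "'o \<Rightarrow> 'm"
  runit :: "'o \<Rightarrow> 'm"
  braid :: "'o \<Rightarrow> 'o \<Rightarrow> 'm"

locale symmetric_monoidal_category = category M
  for M :: "('o, 'm, 'z) smcat_scheme" (structure) +
  assumes ten_ob: "X \<in> Ob M \<Longrightarrow> Y \<in> Ob M \<Longrightarrow> X \<otimes> Y \<in> Ob M"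
    and ten_hom: "f \<in> hom M X X' \<Longrightarrow> g \<in> hom M Y Y' \<Longrightarrow> f \<boxtimes> g \<in> hom M (X \<otimes> Y) (X' \<otimes> Y')"
    and ten_id: "X \<in> Ob M \<Longrightarrow> Y \<in> Ob M \<Longrightarrow> Idn M X \<boxtimes> Idn M Y = Idn M (X \<otimes> Y)"
    and ten_comp: "f \<in> hom M X X' \<Longrightarrow> f' \<in> hom M X' X'' \<Longrightarrow> g \<in> hom M Y Y' \<Longrightarrow> g' \<in> hom M Y' Y'' \<Longrightarrow>
          (f' \<cdot> f) \<boxtimes> (g' \<cdot> g) = (f' \<boxtimes> g') \<cdot> (f \<boxtimes> g)"
    and unit_ob: "\<one> \<in> Ob M"
    and assoc_iso: "X \<in> Ob M \<Longrightarrow> Y \<in> Ob M \<Longrightarrow> Z \<in> Ob M \<Longrightarrow>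
          iso_arr M ((X \<otimes> Y) \<otimes> Z) (X \<otimes> (Y \<otimes> Z)) (assoc M X Y Z)"
    and assoc_nat: "f \<in> hom M X X' \<Longrightarrow> g \<in> hom M Y Y' \<Longrightarrow> h \<in> hom M Z Z' \<Longrightarrow>
          assoc M X' Y' Z' \<cdot> ((f \<boxtimes> g) \<boxtimes> h) = (f \<boxtimes> (g \<boxtimes> h)) \<cdot> assoc M X Y Z"
    and lunit_iso: "X \<in> Ob M \<Longrightarrow> iso_arr M (\<one> \<otimes> X) X (lunit M X)"
    and lunit_nat: "f \<in> hom M X X' \<Longrightarrow> lunit M X' \<cdot> (Idn M \<one> \<boxtimes> f) = f \<cdot> lunit M X"
    and runit_iso: "X \<in> Ob M \<Longrightarrow> iso_arr M (X \<otimes> \<one>) X (runit M X)"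
    and runit_nat: "f \<in> hom M X X' \<Longrightarrow> runit M X' \<cdot> (f \<boxtimes> Idn M \<one>) = f \<cdot> runit M X"
    and braid_iso: "X \<in> Ob M \<Longrightarrow> Y \<in> Ob M \<Longrightarrow> iso_arr M (X \<otimes> Y) (Y \<otimes> X) (braid M X Y)"
    and braid_nat: "f \<in> hom M X X' \<Longrightarrow> g \<in> hom M Y Y' \<Longrightarrow>
          braid M X' Y' \<cdot> (f \<boxtimes> g) = (g \<boxtimes> f) \<cdot> braid M X Y"
    and pentagon: "W \<in> Ob M \<Longrightarrow> X \<in> Ob M \<Longrightarrow> Y \<in> Ob M \<Longrightarrow> Z \<in> Ob M \<Longrightarrow>
          assoc M W X (Y \<otimes> Z) \<cdot> assoc M (W \<otimes> X) Y Z =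
          (Idn M W \<boxtimes> assoc M X Y Z) \<cdot> (assoc M W (X \<otimes> Y) Z \<cdot> (assoc M W X Y \<boxtimes> Idn M Z))"
    and triangle: "X \<in> Ob M \<Longrightarrow> Y \<in> Ob M \<Longrightarrow>
          (Idn M X \<boxtimes> lunit M Y) \<cdot> assoc M X \<one> Y = runit M X \<boxtimes> Idn M Y"
    and hexagon: "X \<in> Ob M \<Longrightarrow> Y \<in> Ob M \<Longrightarrow> Z \<in> Ob M \<Longrightarrow>
          assoc M Y Z X \<cdot> (braid M X (Y \<otimes> Z) \<cdot> assoc M X Y Z) =
          (Idn M Y \<boxtimes> braid M X Z) \<cdot> (assoc M Y X Z \<cdot> (braid M X Y \<boxtimes> Idn M Z))"
    and symmetry: "X \<in> Ob M \<Longrightarrow> Y \<in> Ob M \<Longrightarrow> braid M Y X \<cdot> braid M X Y = Idn M (X \<otimes> Y)"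

locale strict_symmetric_monoidal_functor =
  M: symmetric_monoidal_category M + N: symmetric_monoidal_category N + cat_functor M N F
  for M :: "('o, 'm, 'y) smcat_scheme" and N :: "('p, 'n, 'z) smcat_scheme"
    and F :: "('o, 'm, 'p, 'n) fctr" +
  assumes pres_tenO: "X \<in> Ob M \<Longrightarrow> Y \<in> Ob M \<Longrightarrow> FO F (X \<otimes>\<^bsub>M\<^esub> Y) = FO F X \<otimes>\<^bsub>N\<^esub> FO F Y"
    and pres_tenA: "f \<in> Arr M \<Longrightarrow> g \<in> Arr M \<Longrightarrow> FA F (f \<boxtimes>\<^bsub>M\<^esub> g) = FA F f \<boxtimes>\<^bsub>N\<^esub> FA F g"
    and pres_unit: "FO F \<one>\<^bsub>M\<^esub> = \<one>\<^bsub>N\<^esub>"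
    and pres_assoc: "X \<in> Ob M \<Longrightarrow> Y \<in> Ob M \<Longrightarrow> Z \<in> Ob M \<Longrightarrow>
          FA F (assoc M X Y Z) = assoc N (FO F X) (FO F Y) (FO F Z)"
    and pres_lunit: "X \<in> Ob M \<Longrightarrow> FA F (lunit M X) = lunit N (FO F X)"
    and pres_runit: "X \<in> Ob M \<Longrightarrow> FA F (runit M X) = runit N (FO F X)"
    and pres_braid: "X \<in> Ob M \<Longrightarrow> Y \<in> Ob M \<Longrightarrow>
          FA F (braid M X Y) = braid N (FO F X) (FO F Y)"

text \<open>
  The sets of a set-theoretic universe are modelled as the small subsets of a type \<open>'u\<close>; arbitrary
  subsets of \<open>'u\<close> (and of any other type) play the role of classes. The axioms hold in every
  Grothendieck universe that contains an infinite set (with \<open>enc\<close> the pairing function and \<open>pt\<close> any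
  element). Closure under power sets is not needed and therefore not demanded, so that the axioms
  also cover, for instance, the countable sets.
\<close>

record 'u universe =
  small_sets :: "'u set set"
  enc :: "'u \<times> 'u \<Rightarrow> 'u"
  pt :: 'u

locale set_universe =
  fixes \<U> :: "'u universe"
  assumes enc_inj: "inj (enc \<U>)"
    and small_singleton: "{x} \<in> small_sets \<U>"
    and small_subset: "A \<in> small_sets \<U> \<Longrightarrow> B \<subseteq> A \<Longrightarrow> B \<in> small_sets \<U>"
    and small_Union: "A \<in> small_sets \<U> \<Longrightarrow> (\<And>a. a \<in> A \<Longrightarrow> F a \<in> small_sets \<U>) \<Longrightarrow>
          (\<Union>a\<in>A. F a) \<in> small_sets \<U>"
    and small_infinite: "\<exists>A \<in> small_sets \<U>. infinite A"

definition is_small :: "'u universe \<Rightarrow> 'a set \<Rightarrow> bool" where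
  "is_small \<U> A \<longleftrightarrow> (\<exists>h. inj_on h A \<and> h ` A \<in> small_sets \<U>)"

definition dec :: "'u universe \<Rightarrow> 'u \<Rightarrow> 'u \<times> 'u" where
  "dec \<U> = inv (enc \<U>)"

definition set_prod :: "'u universe \<Rightarrow> 'u set \<Rightarrow> 'u set \<Rightarrow> 'u set" where
  "set_prod \<U> A B = enc \<U> ` (A \<times> B)"

type_synonym 'u set_arr = "'u set \<times> ('u \<Rightarrow> 'u) \<times> 'u set"

definition fn :: "'u set_arr \<Rightarrow> 'u \<Rightarrow> 'u" where
  "fn f = fst (snd f)"

definition Set_cat :: "'u universe \<Rightarrow> ('u set, 'u set_arr) smcat" where
  "Set_cat \<U> = \<lparr>
     Ob = small_sets \<U>,
     Arr = {(A, f, B) |A f B. A \<in> small_sets \<U> \<and> B \<in> small_sets \<U> \<and> f \<in> A \<rightarrow>\<^sub>E B},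
     Dom = (\<lambda>(A, f, B). A),
     Cod = (\<lambda>(A, f, B). B),
     Idn = (\<lambda>A. (A, \<lambda>x\<in>A. x, A)),
     Cmp = (\<lambda>(B', g, C) (A, f, B). (A, compose A g f, C)),
     tenO = set_prod \<U>,
     tenA = (\<lambda>(A, f, B) (A', g, B').
       (set_prod \<U> A A', \<lambda>z\<in>set_prod \<U> A A'. enc \<U> (map_prod f g (dec \<U> z)), set_prod \<U> B B')),
     unitO = {pt \<U>},
     assoc = (\<lambda>A B C.
       (set_prod \<U> (set_prod \<U> A B) C,
        \<lambda>z\<in>set_prod \<U> (set_prod \<U> A B) C.
          (let (w, c) = dec \<U> z; (a, b) = dec \<U> w in enc \<U> (a, enc \<U> (b, c))),
        set_prod \<U> A (set_prod \<U> B C))),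
     lunit = (\<lambda>A. (set_prod \<U> {pt \<U>} A, \<lambda>z\<in>set_prod \<U> {pt \<U>} A. snd (dec \<U> z), A)),
     runit = (\<lambda>A. (set_prod \<U> A {pt \<U>}, \<lambda>z\<in>set_prod \<U> A {pt \<U>}. fst (dec \<U> z), A)),
     braid = (\<lambda>A B.
       (set_prod \<U> A B, \<lambda>z\<in>set_prod \<U> A B. enc \<U> (prod.swap (dec \<U> z)), set_prod \<U> B A)) \<rparr>"

text \<open>Finite tuples in the universe, encoded by iterated pairing; \<open>pt\<close> is the empty tuple.\<close>

primrec tup :: "'u universe \<Rightarrow> 'u list \<Rightarrow> 'u" where
  "tup \<U> [] = pt \<U>"
| "tup \<U> (x # xs) = enc \<U> (x, tup \<U> xs)"

primrec tup_nth :: "'u universe \<Rightarrow> nat \<Rightarrow> 'u \<Rightarrow> 'u" where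
  "tup_nth \<U> 0 z = fst (dec \<U> z)"
| "tup_nth \<U> (Suc i) z = tup_nth \<U> i (snd (dec \<U> z))"

definition tuples :: "'u universe \<Rightarrow> 'u set list \<Rightarrow> 'u set" where
  "tuples \<U> As = tup \<U> ` listset As"

definition set_proj :: "'u universe \<Rightarrow> 'u set list \<Rightarrow> nat \<Rightarrow> 'u set_arr" where
  "set_proj \<U> As i = (tuples \<U> As, \<lambda>z\<in>tuples \<U> As. tup_nth \<U> i z, As ! i)"

definition admissible ::
  "('o, 'm, 'z) cat_scheme \<Rightarrow> ('o, 'm, 'p, 'n) fctr \<Rightarrow> 'o \<Rightarrow> 'o \<Rightarrow> 'n \<Rightarrow> bool" where
  "admissible C U X Y h \<longleftrightarrow> (\<exists>f \<in> hom C X Y. FA U f = h)"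

text \<open>
  A (possibly large) source is given as the collection of its pairs (codomain, arrow): repeating a
  pair in a family affects neither its being initial nor its initial lifts.
\<close>

definition initial_source :: "('o, 'm, 'y) cat_scheme \<Rightarrow> ('p, 'n, 'z) cat_scheme \<Rightarrow>
    ('o, 'm, 'p, 'n) fctr \<Rightarrow> 'o \<Rightarrow> ('o \<times> 'n) set \<Rightarrow> bool" where
  "initial_source C B U X K \<longleftrightarrow>
     (\<forall>W \<in> Ob C. \<forall>h \<in> hom B (FO U W) (FO U X).
        admissible C U W X h \<longleftrightarrow> (\<forall>(Y, k) \<in> K. admissible C U W Y (Cmp B k h)))"

locale topological_functor = cat_functor C B U
  for C :: "('o, 'm, 'y) cat_scheme" and B :: "('p, 'n, 'z) cat_scheme"
    and U :: "('o, 'm, 'p, 'n) fctr" +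
  assumes faithful: "f \<in> hom C X Y \<Longrightarrow> g \<in> hom C X Y \<Longrightarrow> FA U f = FA U g \<Longrightarrow> f = g"
    and amnestic: "X \<in> Ob C \<Longrightarrow> Y \<in> Ob C \<Longrightarrow> FO U X = FO U Y \<Longrightarrow>
          admissible C U X Y (Idn B (FO U X)) \<Longrightarrow> admissible C U Y X (Idn B (FO U X)) \<Longrightarrow> X = Y"
    and initial_lift: "Z \<in> Ob B \<Longrightarrow> (\<And>Y k. (Y, k) \<in> K \<Longrightarrow> Y \<in> Ob C \<and> k \<in> hom B Z (FO U Y)) \<Longrightarrow>
          \<exists>X \<in> Ob C. FO U X = Z \<and> (\<forall>(Y, k) \<in> K. admissible C U X Y k) \<and> initial_source C B U X K"

definition is_product :: "('o, 'm, 'z) cat_scheme \<Rightarrow> 'o list \<Rightarrow> 'o \<Rightarrow> 'm list \<Rightarrow> bool" where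
  "is_product C Xs X ps \<longleftrightarrow>
     X \<in> Ob C \<and> length ps = length Xs \<and> (\<forall>i < length Xs. ps ! i \<in> hom C X (Xs ! i)) \<and>
     (\<forall>W \<in> Ob C. \<forall>fs. length fs = length Xs \<and> (\<forall>i < length Xs. fs ! i \<in> hom C W (Xs ! i)) \<longrightarrow>
        (\<exists>!h. h \<in> hom C W X \<and> (\<forall>i < length Xs. Cmp C (ps ! i) h = fs ! i)))"

text \<open>
  The product cone whose underlying cone is the standard product of sets. When \<open>U\<close> is topological
  over sets it exists (initial lift of the projections) and is unique (by amnesticity).
\<close>

definition prod_cone :: "'u universe \<Rightarrow> ('v, 'm, 'z) cat_scheme \<Rightarrow>
    ('v, 'm, 'u set, 'u set_arr) fctr \<Rightarrow> 'v list \<Rightarrow> 'v \<times> 'm list" where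
  "prod_cone \<U> V U Xs = (THE c. is_product V Xs (fst c) (snd c) \<and>
     FO U (fst c) = tuples \<U> (map (FO U) Xs) \<and>
     (\<forall>i < length Xs. FA U (snd c ! i) = set_proj \<U> (map (FO U) Xs) i))"

definition prodO :: "'u universe \<Rightarrow> ('v, 'm, 'z) cat_scheme \<Rightarrow>
    ('v, 'm, 'u set, 'u set_arr) fctr \<Rightarrow> 'v list \<Rightarrow> 'v" where
  "prodO \<U> V U Xs = fst (prod_cone \<U> V U Xs)"

definition prodP :: "'u universe \<Rightarrow> ('v, 'm, 'z) cat_scheme \<Rightarrow>
    ('v, 'm, 'u set, 'u set_arr) fctr \<Rightarrow> 'v list \<Rightarrow> nat \<Rightarrow> 'm" where
  "prodP \<U> V U Xs i = snd (prod_cone \<U> V U Xs) ! i"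

definition prodA :: "'u universe \<Rightarrow> ('v, 'm, 'z) cat_scheme \<Rightarrow>
    ('v, 'm, 'u set, 'u set_arr) fctr \<Rightarrow> 'm list \<Rightarrow> 'm" where
  "prodA \<U> V U fs = (THE h.
     h \<in> hom V (prodO \<U> V U (map (Dom V) fs)) (prodO \<U> V U (map (Cod V) fs)) \<and>
     (\<forall>i < length fs. Cmp V (prodP \<U> V U (map (Cod V) fs) i) h =
                      Cmp V (fs ! i) (prodP \<U> V U (map (Dom V) fs) i)))"

record ('op, 's) csig =
  Ops :: "'op set"
  Ins :: "'op \<Rightarrow> 's list"
  Out :: "'op \<Rightarrow> 's"

record ('op, 's, 'v) esig = "('op, 's) csig" +
  Par :: "'op \<Rightarrow> 'v"

definition classical_signature ::
  "'u universe \<Rightarrow> 's set \<Rightarrow> ('op, 's, 'z) csig_scheme \<Rightarrow> bool" where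
  "classical_signature \<U> \<S> \<Sigma> \<longleftrightarrow> is_small \<U> (Ops \<Sigma>) \<and>
     (\<forall>\<sigma> \<in> Ops \<Sigma>. set (Ins \<Sigma> \<sigma>) \<subseteq> \<S> \<and> Out \<Sigma> \<sigma> \<in> \<S>)"

definition enriched_signature ::
  "'u universe \<Rightarrow> ('v, 'm) smcat \<Rightarrow> 's set \<Rightarrow> ('op, 's, 'v) esig \<Rightarrow> bool" where
  "enriched_signature \<U> V \<S> \<Sigma> \<longleftrightarrow> is_small \<U> (Ops \<Sigma>) \<and>
     (\<forall>\<sigma> \<in> Ops \<Sigma>. set (Ins \<Sigma> \<sigma>) \<subseteq> \<S> \<and> Out \<Sigma> \<sigma> \<in> \<S> \<and> Par \<Sigma> \<sigma> \<in> Ob V)"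

record ('op, 's, 'v, 'm) alg =
  Carr :: "'s \<Rightarrow> 'v"
  Intp :: "'op \<Rightarrow> 'm"

type_synonym ('op, 's, 'v, 'm) alg_arr =
  "('op, 's, 'v, 'm) alg \<times> ('s \<Rightarrow> 'm) \<times> ('op, 's, 'v, 'm) alg"

definition algebras :: "'u universe \<Rightarrow> ('v, 'm) smcat \<Rightarrow> ('v, 'm, 'u set, 'u set_arr) fctr \<Rightarrow>
    's set \<Rightarrow> ('op, 's, 'v) esig \<Rightarrow> ('op, 's, 'v, 'm) alg set" where
  "algebras \<U> V U \<S> \<Sigma> = {A. Carr A \<in> \<S> \<rightarrow>\<^sub>E Ob V \<and> Intp A \<in> extensional (Ops \<Sigma>) \<and>
     (\<forall>\<sigma> \<in> Ops \<Sigma>. Intp A \<sigma> \<in>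
        hom V (Par \<Sigma> \<sigma> \<otimes>\<^bsub>V\<^esub> prodO \<U> V U (map (Carr A) (Ins \<Sigma> \<sigma>))) (Carr A (Out \<Sigma> \<sigma>)))}"

definition alg_arrs :: "'u universe \<Rightarrow> ('v, 'm) smcat \<Rightarrow> ('v, 'm, 'u set, 'u set_arr) fctr \<Rightarrow>
    's set \<Rightarrow> ('op, 's, 'v) esig \<Rightarrow> ('op, 's, 'v, 'm) alg_arr set" where
  "alg_arrs \<U> V U \<S> \<Sigma> = {(A, f, B) |A f B.
     A \<in> algebras \<U> V U \<S> \<Sigma> \<and> B \<in> algebras \<U> V U \<S> \<Sigma> \<and>
     f \<in> (\<Pi>\<^sub>E S\<in>\<S>. hom V (Carr A S) (Carr B S)) \<and>
     (\<forall>\<sigma> \<in> Ops \<Sigma>. Cmp V (f (Out \<Sigma> \<sigma>)) (Intp A \<sigma>) =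
        Cmp V (Intp B \<sigma>) (Idn V (Par \<Sigma> \<sigma>) \<boxtimes>\<^bsub>V\<^esub> prodA \<U> V U (map f (Ins \<Sigma> \<sigma>))))}"

definition Alg_cat :: "'u universe \<Rightarrow> ('v, 'm) smcat \<Rightarrow> ('v, 'm, 'u set, 'u set_arr) fctr \<Rightarrow>
    's set \<Rightarrow> ('op, 's, 'v) esig \<Rightarrow>
    (('op, 's, 'v, 'm) alg, ('op, 's, 'v, 'm) alg_arr) cat" where
  "Alg_cat \<U> V U \<S> \<Sigma> = \<lparr>
     Ob = algebras \<U> V U \<S> \<Sigma>,
     Arr = alg_arrs \<U> V U \<S> \<Sigma>,
     Dom = (\<lambda>(A, f, B). A),
     Cod = (\<lambda>(A, f, B). B),
     Idn = (\<lambda>A. (A, \<lambda>S\<in>\<S>. Idn V (Carr A S), A)),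
     Cmp = (\<lambda>(B', g, C) (A, f, B). (A, \<lambda>S\<in>\<S>. Cmp V (g S) (f S), C)) \<rparr>"

definition param_power :: "'u universe \<Rightarrow> ('v, 'm) smcat \<Rightarrow> ('v, 'm, 'u set, 'u set_arr) fctr \<Rightarrow>
    'v \<Rightarrow> 's list \<Rightarrow> (('op, 's, 'v, 'm) alg, ('op, 's, 'v, 'm) alg_arr, 'v, 'm) fctr" where
  "param_power \<U> V U P Ss = \<lparr>
     FO = (\<lambda>A. P \<otimes>\<^bsub>V\<^esub> prodO \<U> V U (map (Carr A) Ss)),
     FA = (\<lambda>(A, f, B). Idn V P \<boxtimes>\<^bsub>V\<^esub> prodA \<U> V U (map f Ss)) \<rparr>"

definition carrier_at ::
  "'s \<Rightarrow> (('op, 's, 'v, 'm) alg, ('op, 's, 'v, 'm) alg_arr, 'v, 'm) fctr" where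
  "carrier_at S = \<lparr> FO = (\<lambda>A. Carr A S), FA = (\<lambda>(A, f, B). f S) \<rparr>"

definition algebraic_operation ::
  "'u universe \<Rightarrow> ('v, 'm) smcat \<Rightarrow> ('v, 'm, 'u set, 'u set_arr) fctr \<Rightarrow> 's set \<Rightarrow>
    ('op, 's, 'v) esig \<Rightarrow> 's list \<Rightarrow> 's \<Rightarrow> 'v \<Rightarrow> (('op, 's, 'v, 'm) alg \<Rightarrow> 'm) \<Rightarrow> bool" where
  "algebraic_operation \<U> V U \<S> \<Sigma> Ss S P \<omega> \<longleftrightarrow> set Ss \<subseteq> \<S> \<and> S \<in> \<S> \<and> P \<in> Ob V \<and>
     nat_trans (Alg_cat \<U> V U \<S> \<Sigma>) V (param_power \<U> V U P Ss) (carrier_at S) \<omega>"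

record ('op, 's, 'v, 'm) alg_eqn =
  eqIns :: "'s list"
  eqOut :: 's
  eqPar :: 'v
  eqL :: "('op, 's, 'v, 'm) alg \<Rightarrow> 'm"
  eqR :: "('op, 's, 'v, 'm) alg \<Rightarrow> 'm"

definition enriched_theory ::
  "'u universe \<Rightarrow> ('v, 'm) smcat \<Rightarrow> ('v, 'm, 'u set, 'u set_arr) fctr \<Rightarrow> 's set \<Rightarrow>
    ('op, 's, 'v) esig \<Rightarrow> ('op, 's, 'v, 'm) alg_eqn set \<Rightarrow> bool" where
  "enriched_theory \<U> V U \<S> \<Sigma> E \<longleftrightarrow> enriched_signature \<U> V \<S> \<Sigma> \<and> is_small \<U> E \<and>
     (\<forall>e \<in> E. algebraic_operation \<U> V U \<S> \<Sigma> (eqIns e) (eqOut e) (eqPar e) (eqL e) \<and>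
              algebraic_operation \<U> V U \<S> \<Sigma> (eqIns e) (eqOut e) (eqPar e) (eqR e))"

definition theory_algebras ::
  "'u universe \<Rightarrow> ('v, 'm) smcat \<Rightarrow> ('v, 'm, 'u set, 'u set_arr) fctr \<Rightarrow> 's set \<Rightarrow>
    ('op, 's, 'v) esig \<Rightarrow> ('op, 's, 'v, 'm) alg_eqn set \<Rightarrow> ('op, 's, 'v, 'm) alg set" where
  "theory_algebras \<U> V U \<S> \<Sigma> E = {A \<in> algebras \<U> V U \<S> \<Sigma>. \<forall>e \<in> E. eqL e A = eqR e A}"

text \<open>
  A classical algebra is an algebra enriched in sets with one-point parameters; as usual the
  parameter is dropped and operations are functions on lists of arguments.
\<close>

record ('op, 's, 'u) calg =
  cCarr :: "'s \<Rightarrow> 'u set"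
  cIntp :: "'op \<Rightarrow> 'u list \<Rightarrow> 'u"

definition classical_algebras ::
  "'u universe \<Rightarrow> 's set \<Rightarrow> ('op, 's) csig \<Rightarrow> ('op, 's, 'u) calg set" where
  "classical_algebras \<U> \<S> \<Sigma> = {A. cCarr A \<in> \<S> \<rightarrow>\<^sub>E small_sets \<U> \<and>
     cIntp A \<in> (\<Pi>\<^sub>E \<sigma>\<in>Ops \<Sigma>. listset (map (cCarr A) (Ins \<Sigma> \<sigma>)) \<rightarrow>\<^sub>E cCarr A (Out \<Sigma> \<sigma>))}"

text \<open>The variables of sort \<open>S\<close> are the pairs \<open>(S, n)\<close>.\<close>

type_synonym 's var = "'s \<times> nat"

definition is_context :: "'s set \<Rightarrow> 's var list \<Rightarrow> bool" where
  "is_context \<S> vs \<longleftrightarrow> distinct vs \<and> fst ` set vs \<subseteq> \<S>"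

datatype ('op, 's) trm = Var "'s var" | App 'op "('op, 's) trm list"

inductive term_in_context ::
  "('op, 's) csig \<Rightarrow> 's var list \<Rightarrow> ('op, 's) trm \<Rightarrow> 's \<Rightarrow> bool" for \<Sigma> vs where
  "v \<in> set vs \<Longrightarrow> term_in_context \<Sigma> vs (Var v) (fst v)"
| "\<sigma> \<in> Ops \<Sigma> \<Longrightarrow> length ts = length (Ins \<Sigma> \<sigma>) \<Longrightarrow>
     (\<And>j. j < length ts \<Longrightarrow> term_in_context \<Sigma> vs (ts ! j) (Ins \<Sigma> \<sigma> ! j)) \<Longrightarrow>
     term_in_context \<Sigma> vs (App \<sigma> ts) (Out \<Sigma> \<sigma>)"

primrec eval_term :: "('op, 's, 'u) calg \<Rightarrow> ('s var \<Rightarrow> 'u) \<Rightarrow> ('op, 's) trm \<Rightarrow> 'u" where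
  "eval_term A \<rho> (Var v) = \<rho> v"
| "eval_term A \<rho> (App \<sigma> ts) = cIntp A \<sigma> (map (eval_term A \<rho>) ts)"

definition interp_term ::
  "('op, 's, 'u) calg \<Rightarrow> 's var list \<Rightarrow> ('op, 's) trm \<Rightarrow> 'u list \<Rightarrow> 'u" where
  "interp_term A vs t = (\<lambda>xs \<in> listset (map (cCarr A \<circ> fst) vs).
     eval_term A (\<lambda>v. the (map_of (zip vs xs) v)) t)"

record ('op, 's) syn_eqn =
  ctxt :: "'s var list"
  srt :: 's
  lhs :: "('op, 's) trm"
  rhs :: "('op, 's) trm"

definition classical_theory ::
  "'u universe \<Rightarrow> 's set \<Rightarrow> ('op, 's) csig \<Rightarrow> ('op, 's) syn_eqn set \<Rightarrow> bool" where
  "classical_theory \<U> \<S> \<Sigma> E \<longleftrightarrow> classical_signature \<U> \<S> \<Sigma> \<and> is_small \<U> E \<and>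
     (\<forall>e \<in> E. is_context \<S> (ctxt e) \<and>
        term_in_context \<Sigma> (ctxt e) (lhs e) (srt e) \<and> term_in_context \<Sigma> (ctxt e) (rhs e) (srt e))"

definition classical_theory_algebras ::
  "'u universe \<Rightarrow> 's set \<Rightarrow> ('op, 's) csig \<Rightarrow> ('op, 's) syn_eqn set \<Rightarrow> ('op, 's, 'u) calg set" where
  "classical_theory_algebras \<U> \<S> \<Sigma> E = {A \<in> classical_algebras \<U> \<S> \<Sigma>.
     \<forall>e \<in> E. interp_term A (ctxt e) (lhs e) = interp_term A (ctxt e) (rhs e)}"

definition und_sig ::
  "('v, 'm, 'u set, 'u set_arr) fctr \<Rightarrow> ('op, 's, 'v) esig \<Rightarrow> ('op \<times> 'u, 's) csig" where
  "und_sig U \<Sigma> = \<lparr>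
     Ops = (SIGMA \<sigma> : Ops \<Sigma>. FO U (Par \<Sigma> \<sigma>)),
     Ins = (\<lambda>(\<sigma>, p). Ins \<Sigma> \<sigma>),
     Out = (\<lambda>(\<sigma>, p). Out \<Sigma> \<sigma>) \<rparr>"

definition und_alg :: "'u universe \<Rightarrow> ('v, 'm, 'u set, 'u set_arr) fctr \<Rightarrow> 's set \<Rightarrow>
    ('op, 's, 'v) esig \<Rightarrow> ('op, 's, 'v, 'm) alg \<Rightarrow> ('op \<times> 'u, 's, 'u) calg" where
  "und_alg \<U> U \<S> \<Sigma> A = \<lparr>
     cCarr = (\<lambda>S\<in>\<S>. FO U (Carr A S)),
     cIntp = (\<lambda>(\<sigma>, p) \<in> Ops (und_sig U \<Sigma>).
        \<lambda>xs \<in> listset (map (\<lambda>S. FO U (Carr A S)) (Ins \<Sigma> \<sigma>)).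
          fn (FA U (Intp A \<sigma>)) (enc \<U> (p, tup \<U> xs))) \<rparr>"

end

(*
  A hom out of P (x) (X_1 x ... x X_n) is determined by its values at (p, x_1, ..., x_n), so two
  operations in an enriched algebra agree iff they agree pointwise.

  From enriched to classical equations: lift the classical term algebra over variables v_1, ..., v_n
  initially along all evaluation maps into underlying algebras of enriched ones. The structure maps
  are then admissible, so this is the free enriched algebra F, and by naturality an algebraic
  operation w satisfies w_A(p, a) = t(a), where t is the term w_F(p, v).

  From classical to enriched equations: a term is interpreted as an operation whose parameter is not
  the unit but the discrete object D on one point. Every function out of D is admissible, in
  particular D -> P for each parameter p of P and the diagonal D -> D (x) D, and these suffice to
  form admissible composites of operations.
*)
theory Submission
  imports Defs
begin

section \<open>Small sets and tuples\<close>

text \<open>Why the unit fails as a parameter: take sets with a binary relation, with the cartesian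
  product as tensor. The unit is a point with a loop, and its maps into \<open>P\<close> reach only
  the points of \<open>P\<close> that carry a loop. If \<open>p\<close> has none, sigma(p, -) need
  not preserve the relation, so it is no operation with unit parameter. Over a loop-free point it is
  one. For other tensors a product with the discrete point need not be discrete, so admissibility
  has to be proved along the term. A tensor need not have diagonals either: several arguments share
  their input through the cartesian product, and only the parameter is duplicated. The structure
  maps of the free algebra are admissible because a term operation followed by an evaluation in B is
  the evaluation of the arguments followed by the operation of B, which is admissible; initiality
  reflects this. The evaluations range over all algebras and valuations, so lifts of large sources
  are essential. The carriers, however, must be small, so terms are coded in \<open>'u\<close>; that
  there are few enough of them rests on countable unions being small.\<close>

lemma in_listset_iff: "xs \<in> listset As \<longleftrightarrow> list_all2 (\<in>) xs As"
proof (induction As arbitrary: xs)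
  case (Cons A As)
  then show ?case
    by (cases xs) (auto simp: set_Cons_def)
qed auto

lemma in_listset_conv_nth:
  "xs \<in> listset As \<longleftrightarrow> length xs = length As \<and> (\<forall>i < length As. xs ! i \<in> As ! i)"
  by (auto simp: in_listset_iff list_all2_conv_all_nth)

context set_universe
begin

lemma dec_enc [simp]: "dec \<U> (enc \<U> z) = z"
  by (simp add: dec_def enc_inj)

lemma enc_eq_iff [simp]: "enc \<U> z = enc \<U> z' \<longleftrightarrow> z = z'"
  using enc_inj by (auto dest: injD)

lemma tup_nth_tup [simp]: "i < length xs \<Longrightarrow> tup_nth \<U> i (tup \<U> xs) = xs ! i"
  by (induction xs arbitrary: i) (auto simp: nth_Cons split: nat.split)

lemma tup_eq_iff: "length xs = length ys \<Longrightarrow> tup \<U> xs = tup \<U> ys \<longleftrightarrow> xs = ys"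
  by (induction xs ys rule: list_induct2) auto

lemma tuplesE:
  assumes "z \<in> tuples \<U> As"
  obtains xs where "z = tup \<U> xs" "length xs = length As" "\<And>i. i < length As \<Longrightarrow> xs ! i \<in> As ! i"
  using assms by (auto simp: tuples_def in_listset_conv_nth)

lemma tup_in_tuples [simp]: "xs \<in> listset As \<Longrightarrow> tup \<U> xs \<in> tuples \<U> As"
  by (auto simp: tuples_def)

lemma tuples_eqI:
  assumes "z \<in> tuples \<U> As" "z' \<in> tuples \<U> As"
    and "\<And>i. i < length As \<Longrightarrow> tup_nth \<U> i z = tup_nth \<U> i z'"
  shows "z = z'"
  using assms by (elim tuplesE) (auto intro!: nth_equalityI arg_cong[of _ _ "tup \<U>"])

lemma tup_nth_in: "z \<in> tuples \<U> As \<Longrightarrow> i < length As \<Longrightarrow> tup_nth \<U> i z \<in> As ! i"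
  by (elim tuplesE) auto

lemma small_image:
  assumes "A \<in> small_sets \<U>"
  shows "f ` A \<in> small_sets \<U>"
proof -
  have "(\<Union>a\<in>A. {f a}) \<in> small_sets \<U>"
    by (intro small_Union assms small_singleton)
  then show ?thesis
    by (simp add: UNION_singleton_eq_range)
qed

text \<open>Small sets are closed under images, so the inverse of an injection carries its small
  image back to \<open>A\<close>.\<close>

lemma is_small_iff: "is_small \<U> A \<longleftrightarrow> A \<in> small_sets \<U>"
proof
  assume "is_small \<U> A"
  then obtain h where h: "inj_on h A" "h ` A \<in> small_sets \<U>"
    by (auto simp: is_small_def)
  from small_image[OF h(2), of "inv_into A h"] show "A \<in> small_sets \<U>"
    using h(1) by simp
next
  assume "A \<in> small_sets \<U>"
  then show "is_small \<U> A"
    unfolding is_small_def by (intro exI[of _ "\<lambda>x. x"]) auto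
qed

lemma is_small_subset: "is_small \<U> A \<Longrightarrow> B \<subseteq> A \<Longrightarrow> is_small \<U> B"
  unfolding is_small_def by (meson image_mono inj_on_subset small_subset)

lemma is_small_image_inj: "inj_on f A \<Longrightarrow> is_small \<U> (f ` A) \<Longrightarrow> is_small \<U> A"
  unfolding is_small_def by (metis comp_inj_on image_comp)

text \<open>A right inverse of \<open>f\<close> embeds the image into \<open>A\<close>.\<close>

lemma is_small_image:
  assumes "is_small \<U> A"
  shows "is_small \<U> (f ` A)"
proof (rule is_small_image_inj)
  show "inj_on (inv_into A f) (f ` A)"
    by (rule inj_on_inv_into) simp
  show "is_small \<U> (inv_into A f ` f ` A)"
    by (rule is_small_subset[OF assms]) (auto simp: inv_into_into)
qed

lemma small_UN:
  assumes "is_small \<U> I" "\<And>i. i \<in> I \<Longrightarrow> F i \<in> small_sets \<U>"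
  shows "(\<Union>i\<in>I. F i) \<in> small_sets \<U>"
proof -
  obtain h where h: "inj_on h I" "h ` I \<in> small_sets \<U>"
    using assms(1) by (auto simp: is_small_def)
  have "(\<Union>a\<in>h ` I. F (inv_into I h a)) \<in> small_sets \<U>"
    by (intro small_Union h assms) (auto simp: h(1))
  then show ?thesis
    using h(1) by simp
qed

text \<open>Makes countable unions small; the terms in a context will be exhausted by the terms of
  bounded size.\<close>

lemma is_small_UNIV_nat: "is_small \<U> (UNIV :: nat set)"
proof -
  obtain A where A: "A \<in> small_sets \<U>" "infinite A"
    using small_infinite by auto
  then obtain g :: "nat \<Rightarrow> 'u" where g: "inj g" "range g \<subseteq> A"
    using infinite_countable_subset[OF A(2)] by auto
  then show ?thesis
    using A small_subset by (auto simp: is_small_def)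
qed

lemma is_small_finite:
  assumes "finite A"
  shows "is_small \<U> A"
proof -
  obtain f :: "_ \<Rightarrow> nat" where "inj_on f A"
    using finite_imp_inj_to_nat_seg[OF assms] by auto
  then show ?thesis
    by (rule is_small_image_inj) (rule is_small_subset[OF is_small_UNIV_nat], simp)
qed

lemma small_Un:
  assumes "A \<in> small_sets \<U>" "B \<in> small_sets \<U>"
  shows "A \<union> B \<in> small_sets \<U>"
proof -
  \<comment> \<open>Unions are available for families with a small index set, so the two sets are
    indexed by \<open>bool\<close>.\<close>
  have "(\<Union>b\<in>UNIV. if b then A else B) \<in> small_sets \<U>"
    by (rule small_UN) (auto simp: is_small_finite assms)
  moreover have "(\<Union>b\<in>UNIV. if b then A else B) = A \<union> B"
    by (auto split: if_splits)
  ultimately show ?thesis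
    by simp
qed

lemma small_set_prod:
  assumes "A \<in> small_sets \<U>" "B \<in> small_sets \<U>"
  shows "set_prod \<U> A B \<in> small_sets \<U>"
proof -
  have "(\<Union>a\<in>A. (\<lambda>b. enc \<U> (a, b)) ` B) \<in> small_sets \<U>"
    by (intro small_Union small_image assms)
  moreover have "(\<Union>a\<in>A. (\<lambda>b. enc \<U> (a, b)) ` B) = set_prod \<U> A B"
    by (auto simp: set_prod_def)
  ultimately show ?thesis
    by simp
qed

lemma is_small_Sigma:
  assumes "is_small \<U> I" "\<And>i. i \<in> I \<Longrightarrow> is_small \<U> (F i)"
  shows "is_small \<U> (Sigma I F)"
proof -
  obtain h where h: "inj_on h I" "h ` I \<in> small_sets \<U>"
    using assms(1) by (auto simp: is_small_def)
  obtain g where g: "\<And>i. i \<in> I \<Longrightarrow> inj_on (g i) (F i)" "\<And>i. i \<in> I \<Longrightarrow> g i ` F i \<in> small_sets \<U>"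
    using assms(2) unfolding is_small_def by metis
  \<comment> \<open>Each fibre has its own injection \<open>g i\<close>; the code \<open>h i\<close>
    of the index keeps different fibres apart.\<close>
  define c where "c = (\<lambda>(i, x). enc \<U> (h i, g i x))"
  have "inj_on c (Sigma I F)"
    using h(1) g(1) by (auto simp: c_def inj_on_def)
  moreover have "c ` Sigma I F = (\<Union>i\<in>I. (\<lambda>y. enc \<U> (h i, y)) ` g i ` F i)"
    by (force simp: c_def)
  moreover have "\<dots> \<in> small_sets \<U>"
    by (intro small_UN assms small_image g)
  ultimately show ?thesis
    by (auto simp: is_small_def)
qed

lemma tuples_Nil [simp]: "tuples \<U> [] = {pt \<U>}"
  by (auto simp: tuples_def)

lemma tuples_Cons: "tuples \<U> (A # As) = set_prod \<U> A (tuples \<U> As)"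
  by (auto simp: tuples_def set_Cons_def set_prod_def image_iff) (metis tup.simps(2))+

lemma small_tuples: "set As \<subseteq> small_sets \<U> \<Longrightarrow> tuples \<U> As \<in> small_sets \<U>"
  by (induction As) (auto simp: tuples_Cons small_set_prod small_singleton)

end

section \<open>Smallness of the set of terms in a context\<close>

inductive_cases term_in_context_VarE: "term_in_context \<Sigma> vs (Var v) S"
inductive_cases term_in_context_AppE: "term_in_context \<Sigma> vs (App \<sigma> ts) S"

context set_universe
begin

text \<open>An encoding of terms in \<open>'u\<close>: the tags \<open>a\<close> and
  \<open>b\<close> separate variables from applications, while \<open>hv\<close> and
  \<open>ho\<close> are meant as injective codes of the variables and of the operation
  symbols.\<close>

primrec code :: "'u \<Rightarrow> 'u \<Rightarrow> ('s var \<Rightarrow> 'u) \<Rightarrow> ('op \<Rightarrow> 'u) \<Rightarrow> ('op, 's) trm \<Rightarrow> 'u" where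
  "code a b hv ho (Var v) = enc \<U> (a, hv v)"
| "code a b hv ho (App \<sigma> ts) = enc \<U> (b, enc \<U> (ho \<sigma>, tup \<U> (map (code a b hv ho) ts)))"

text \<open>\<open>tup\<close> does not record lengths, since the empty tuple \<open>pt\<close> may
  itself be the code of a pair. Injectivity is therefore claimed for well-formed terms, where equal
  head symbols force equal numbers of arguments.\<close>

lemma code_inj:
  assumes "a \<noteq> b" "inj_on hv (set vs)" "inj_on ho (Ops \<Sigma>)"
    and "term_in_context \<Sigma> vs t S" "term_in_context \<Sigma> vs t' S'"
    and "code a b hv ho t = code a b hv ho t'"
  shows "t = t'"
  using assms(4-6)
proof (induction arbitrary: t' S' rule: term_in_context.induct)
  case (1 v)
  then show ?case
    using assms(1,2) by (cases t') (auto elim!: term_in_context_VarE dest: inj_onD)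
next
  case (2 \<sigma> ts)
  then obtain \<sigma>' ts' where t': "t' = App \<sigma>' ts'"
    using assms(1) by (cases t') auto
  from 2(5) have ts': "\<sigma>' \<in> Ops \<Sigma>" "length ts' = length (Ins \<Sigma> \<sigma>')"
    "\<And>j. j < length ts' \<Longrightarrow> term_in_context \<Sigma> vs (ts' ! j) (Ins \<Sigma> \<sigma>' ! j)"
    unfolding t' by (auto elim!: term_in_context_AppE)
  have "\<sigma>' = \<sigma>"
    using 2 ts' assms(3) by (auto simp: t' inj_on_def)
  moreover have "map (code a b hv ho) ts = map (code a b hv ho) ts'"
    using 2 ts' by (simp add: t' \<open>\<sigma>' = \<sigma>\<close> tup_eq_iff)
  then have "ts = ts'"
    using 2(2,4) ts'(2,3) unfolding \<open>\<sigma>' = \<sigma>\<close> list_eq_iff_nth_eq by (metis length_map nth_map)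
  ultimately show ?case
    by (simp add: t')
qed

text \<open>The codes of terms of size below \<open>n\<close> form a small set by induction on
  \<open>n\<close>, and the codes of all terms are the countable union of these sets.\<close>

lemma is_small_terms:
  assumes "is_small \<U> (Ops \<Sigma>)"
  shows "is_small \<U> {t. \<exists>S. term_in_context \<Sigma> vs t S}"
proof -
  obtain ho where ho: "inj_on ho (Ops \<Sigma>)" "ho ` Ops \<Sigma> \<in> small_sets \<U>"
    using assms by (auto simp: is_small_def)
  obtain hv where hv: "inj_on hv (set vs)" "hv ` set vs \<in> small_sets \<U>"
    using is_small_finite[of "set vs"] by (auto simp: is_small_def)
  obtain a b :: 'u where ab: "a \<noteq> b"
    using small_infinite by (metis finite.emptyI finite_insert infinite_super insertI1 subsetI singletonD)
  let ?c = "code a b hv ho"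
  define T where "T n = {t. \<exists>S. term_in_context \<Sigma> vs t S \<and> size t < n}" for n
  have small: "?c ` T n \<in> small_sets \<U>" for n
  proof (induction n)
    case 0
    then show ?case
      using small_subset[OF small_singleton] by (simp add: T_def)
  next
    case (Suc n)
    \<comment> \<open>An overestimate suffices because subsets of small sets are small: sorts are
      ignored, and each argument ranges over the codes of all terms of size below
      \<open>n\<close>.\<close>
    let ?ops = "\<Union>\<sigma>\<in>Ops \<Sigma>. (\<lambda>z. enc \<U> (b, enc \<U> (ho \<sigma>, z))) `
      tuples \<U> (replicate (length (Ins \<Sigma> \<sigma>)) (?c ` T n))"
    let ?vars = "(\<lambda>x. enc \<U> (a, x)) ` hv ` set vs"
    have "?vars \<union> ?ops \<in> small_sets \<U>"
      by (intro small_Un small_image hv small_UN assms small_tuples) (use Suc in auto)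
    moreover have "?c t \<in> ?vars \<union> ?ops" if "t \<in> T (Suc n)" for t
    proof (cases t)
      case (Var v)
      then show ?thesis
        using that by (auto simp: T_def elim!: term_in_context_VarE)
    next
      case (App \<sigma> ts)
      with that have ts: "\<sigma> \<in> Ops \<Sigma>" "length ts = length (Ins \<Sigma> \<sigma>)"
        "\<And>j. j < length ts \<Longrightarrow> term_in_context \<Sigma> vs (ts ! j) (Ins \<Sigma> \<sigma> ! j)"
        and size: "size_list size ts < n"
        by (auto simp: T_def elim!: term_in_context_AppE)
      have "ts ! j \<in> T n" if "j < length ts" for j
        using ts(3)[OF that] size_list_estimation'[of "ts ! j" ts "size (ts ! j)" size] size that
        by (auto simp: T_def)
      then have "map ?c ts \<in> listset (replicate (length (Ins \<Sigma> \<sigma>)) (?c ` T n))"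
        using ts(2) by (auto simp: in_listset_conv_nth)
      then show ?thesis
        using ts(1) tup_in_tuples unfolding App code.simps by blast
    qed
    ultimately show ?case
      by (blast intro: small_subset)
  qed
  have "(\<Union>n. ?c ` T n) \<in> small_sets \<U>"
    by (intro small_UN is_small_UNIV_nat small)
  moreover have "(\<Union>n. ?c ` T n) = ?c ` {t. \<exists>S. term_in_context \<Sigma> vs t S}"
    by (auto simp: T_def)
  moreover have "inj_on ?c {t. \<exists>S. term_in_context \<Sigma> vs t S}"
    by (auto intro!: inj_onI dest: code_inj[OF ab hv(1) ho(1)])
  ultimately show ?thesis
    by (auto simp: is_small_def)
qed

end

section \<open>Admissible functions\<close>

lemma set_hom_iff:
  "k \<in> hom (Set_cat \<U>) A B \<longleftrightarrow>
     A \<in> small_sets \<U> \<and> B \<in> small_sets \<U> \<and> k = (A, fn k, B) \<and> fn k \<in> A \<rightarrow>\<^sub>E B"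
  by (cases k) (auto simp: hom_def Set_cat_def fn_def)

lemma set_homI:
  "A \<in> small_sets \<U> \<Longrightarrow> B \<in> small_sets \<U> \<Longrightarrow> f \<in> A \<rightarrow> B \<Longrightarrow>
     (A, restrict f A, B) \<in> hom (Set_cat \<U>) A B"
  by (auto simp: set_hom_iff fn_def)

lemma Cmp_Set [simp]:
  "Cmp (Set_cat \<U>) (B', g, C) (A, f, B) = (A, compose A g f, C)"
  by (simp add: Set_cat_def)

locale topological_setting =
  set_universe \<U> + topological_functor V "Set_cat \<U>" U +
  strict_symmetric_monoidal_functor V "Set_cat \<U>" U
  for \<U> :: "'u universe" and V :: "('v, 'm) smcat"
    and U :: "('v, 'm, 'u set, 'u set_arr) fctr"
begin

abbreviation act :: "'m \<Rightarrow> 'u \<Rightarrow> 'u" where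
  "act m \<equiv> fn (FA U m)"

text \<open>Differs from \<open>admissible\<close> in taking a bare function and comparing it on the
  carrier only. Composites can thus be written as plain lambda terms, without restricting them or
  forming triples.\<close>

definition adm :: "'v \<Rightarrow> 'v \<Rightarrow> ('u \<Rightarrow> 'u) \<Rightarrow> bool" where
  "adm X Y f \<longleftrightarrow> (\<exists>m \<in> hom V X Y. \<forall>x \<in> FO U X. act m x = f x)"

lemma hom_ob: "m \<in> hom V X Y \<Longrightarrow> X \<in> Ob V \<and> Y \<in> Ob V"
  using C.dom_ob C.cod_ob by (auto simp: hom_def)

lemma FO_small: "X \<in> Ob V \<Longrightarrow> FO U X \<in> small_sets \<U>"
  using fun_ob by (simp add: Set_cat_def)

lemma FA_hom:
  assumes "m \<in> hom V X Y"
  shows "FA U m = (FO U X, act m, FO U Y)" and "act m \<in> FO U X \<rightarrow>\<^sub>E FO U Y"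
  using fun_hom[OF assms] by (auto simp: set_hom_iff)

lemma act_in: "m \<in> hom V X Y \<Longrightarrow> x \<in> FO U X \<Longrightarrow> act m x \<in> FO U Y"
  using FA_hom(2) by auto

text \<open>Faithfulness, together with extensionality of the functions in \<open>Set_cat\<close>:
  agreement on the carrier already makes the images under \<open>U\<close> equal.\<close>

lemma hom_eqI:
  assumes "m \<in> hom V X Y" "n \<in> hom V X Y" "\<And>x. x \<in> FO U X \<Longrightarrow> act m x = act n x"
  shows "m = n"
proof (rule faithful[OF assms(1,2)])
  have "act m = act n"
    using FA_hom(2)[OF assms(1)] FA_hom(2)[OF assms(2)] assms(3) by (rule PiE_ext)
  then show "FA U m = FA U n"
    using FA_hom(1)[OF assms(1)] FA_hom(1)[OF assms(2)] by simp
qed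

lemma act_id: "X \<in> Ob V \<Longrightarrow> x \<in> FO U X \<Longrightarrow> act (Idn V X) x = x"
  by (simp add: fun_id) (simp add: Set_cat_def fn_def)

lemma act_comp:
  assumes "m \<in> hom V X Y" "n \<in> hom V Y Z" "x \<in> FO U X"
  shows "act (Cmp V n m) x = act n (act m x)"
proof -
  have "FA U (Cmp V n m) = Cmp (Set_cat \<U>) (FO U Y, act n, FO U Z) (FO U X, act m, FO U Y)"
    using fun_comp[OF assms(1,2)] FA_hom(1)[OF assms(1)] FA_hom(1)[OF assms(2)] by simp
  then show ?thesis
    using assms(3) by (simp add: fn_def compose_def)
qed

lemma FO_ten: "X \<in> Ob V \<Longrightarrow> Y \<in> Ob V \<Longrightarrow> FO U (X \<otimes>\<^bsub>V\<^esub> Y) = set_prod \<U> (FO U X) (FO U Y)"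
  by (simp add: pres_tenO) (simp add: Set_cat_def)

lemma FO_unit: "FO U \<one>\<^bsub>V\<^esub> = {pt \<U>}"
  by (simp add: pres_unit) (simp add: Set_cat_def)

lemma enc_in_set_prod [simp]: "enc \<U> (a, b) \<in> set_prod \<U> A B \<longleftrightarrow> a \<in> A \<and> b \<in> B"
  by (auto simp: set_prod_def image_iff)

lemma set_prodE:
  assumes "z \<in> set_prod \<U> A B"
  obtains a b where "z = enc \<U> (a, b)" "a \<in> A" "b \<in> B"
  using assms by (auto simp: set_prod_def)

lemma act_ten:
  assumes "m \<in> hom V X X'" "n \<in> hom V Y Y'" "a \<in> FO U X" "b \<in> FO U Y"
  shows "act (m \<boxtimes>\<^bsub>V\<^esub> n) (enc \<U> (a, b)) = enc \<U> (act m a, act n b)"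
proof -
  have "FA U (m \<boxtimes>\<^bsub>V\<^esub> n) = tenA (Set_cat \<U>) (FO U X, act m, FO U X') (FO U Y, act n, FO U Y')"
    using pres_tenA[of m n] FA_hom(1)[OF assms(1)] FA_hom(1)[OF assms(2)] assms(1,2)
    by (auto simp: hom_def)
  then show ?thesis
    using assms(3,4) by (simp add: Set_cat_def fn_def)
qed

lemma adm_hom: "m \<in> hom V X Y \<Longrightarrow> adm X Y (act m)"
  by (auto simp: adm_def)

lemma adm_cong: "adm X Y f \<Longrightarrow> (\<And>x. x \<in> FO U X \<Longrightarrow> f x = g x) \<Longrightarrow> adm X Y g"
  by (force simp: adm_def)

lemma adm_ob: "adm X Y f \<Longrightarrow> X \<in> Ob V \<and> Y \<in> Ob V"
  using hom_ob by (auto simp: adm_def)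

lemma adm_in: "adm X Y f \<Longrightarrow> x \<in> FO U X \<Longrightarrow> f x \<in> FO U Y"
  using act_in by (force simp: adm_def)

lemma adm_comp:
  assumes "adm X Y f" "adm Y Z g"
  shows "adm X Z (\<lambda>x. g (f x))"
proof -
  obtain m n where m: "m \<in> hom V X Y" "\<forall>x\<in>FO U X. act m x = f x"
    and n: "n \<in> hom V Y Z" "\<forall>x\<in>FO U Y. act n x = g x"
    using assms by (auto simp: adm_def)
  have "Cmp V n m \<in> hom V X Z"
    by (rule C.comp_hom[OF m(1) n(1)])
  moreover have "act (Cmp V n m) x = g (f x)" if "x \<in> FO U X" for x
    using act_comp[OF m(1) n(1) that] act_in[OF m(1) that] m(2) n(2) that by simp
  ultimately show ?thesis
    by (auto simp: adm_def)
qed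

lemma adm_id: "X \<in> Ob V \<Longrightarrow> adm X X (\<lambda>x. x)"
  using C.id_hom act_id by (auto simp: adm_def)

lemma adm_ten:
  assumes "adm X X' f" "adm Y Y' g"
  shows "adm (X \<otimes>\<^bsub>V\<^esub> Y) (X' \<otimes>\<^bsub>V\<^esub> Y') (\<lambda>z. enc \<U> (map_prod f g (dec \<U> z)))"
proof -
  obtain m n where m: "m \<in> hom V X X'" "\<forall>x\<in>FO U X. act m x = f x"
    and n: "n \<in> hom V Y Y'" "\<forall>x\<in>FO U Y. act n x = g x"
    using assms by (auto simp: adm_def)
  have "m \<boxtimes>\<^bsub>V\<^esub> n \<in> hom V (X \<otimes>\<^bsub>V\<^esub> Y) (X' \<otimes>\<^bsub>V\<^esub> Y')"
    by (rule M.ten_hom[OF m(1) n(1)])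
  moreover have "act (m \<boxtimes>\<^bsub>V\<^esub> n) z = enc \<U> (map_prod f g (dec \<U> z))" if "z \<in> FO U (X \<otimes>\<^bsub>V\<^esub> Y)" for z
  proof -
    have "z \<in> set_prod \<U> (FO U X) (FO U Y)"
      using that adm_ob assms FO_ten by auto
    then show ?thesis
      by (elim set_prodE) (simp add: act_ten[OF m(1) n(1)] m(2) n(2))
  qed
  ultimately show ?thesis
    by (auto simp: adm_def)
qed

text \<open>\<open>U\<close> preserves the associator strictly, so rebracketing of pairs underlies a
  morphism.\<close>

lemma adm_assoc:
  assumes "X \<in> Ob V" "Y \<in> Ob V" "Z \<in> Ob V"
  shows "adm ((X \<otimes>\<^bsub>V\<^esub> Y) \<otimes>\<^bsub>V\<^esub> Z) (X \<otimes>\<^bsub>V\<^esub> (Y \<otimes>\<^bsub>V\<^esub> Z))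
    (\<lambda>z. let (w, c) = dec \<U> z; (a, b) = dec \<U> w in enc \<U> (a, enc \<U> (b, c)))"
proof -
  have "assoc V X Y Z \<in> hom V ((X \<otimes>\<^bsub>V\<^esub> Y) \<otimes>\<^bsub>V\<^esub> Z) (X \<otimes>\<^bsub>V\<^esub> (Y \<otimes>\<^bsub>V\<^esub> Z))"
    using M.assoc_iso assms by (auto simp: iso_arr_def)
  moreover have "FO U ((X \<otimes>\<^bsub>V\<^esub> Y) \<otimes>\<^bsub>V\<^esub> Z) = set_prod \<U> (set_prod \<U> (FO U X) (FO U Y)) (FO U Z)"
    using assms by (simp add: FO_ten M.ten_ob)
  ultimately show ?thesis
    unfolding adm_def by (intro bexI[of _ "assoc V X Y Z"]) (simp_all add: pres_assoc assms Set_cat_def fn_def)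
qed

text \<open>A tensor need not have projections; a factor is discarded by mapping it to the unit
  first.\<close>

lemma adm_lunit:
  assumes "X \<in> Ob V"
  shows "adm (\<one>\<^bsub>V\<^esub> \<otimes>\<^bsub>V\<^esub> X) X (\<lambda>z. snd (dec \<U> z))"
proof -
  have "lunit V X \<in> hom V (\<one>\<^bsub>V\<^esub> \<otimes>\<^bsub>V\<^esub> X) X"
    using M.lunit_iso assms by (auto simp: iso_arr_def)
  moreover have "FO U (\<one>\<^bsub>V\<^esub> \<otimes>\<^bsub>V\<^esub> X) = set_prod \<U> {pt \<U>} (FO U X)"
    using assms by (simp add: FO_ten FO_unit M.unit_ob)
  ultimately show ?thesis
    unfolding adm_def by (intro bexI[of _ "lunit V X"]) (simp_all add: pres_lunit assms Set_cat_def fn_def)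
qed

section \<open>Amnesticity and initial lifts in terms of \<open>adm\<close>\<close>

lemma admissible_iff:
  assumes "X \<in> Ob V" "Y \<in> Ob V" "k \<in> hom (Set_cat \<U>) (FO U X) (FO U Y)"
  shows "admissible V U X Y k \<longleftrightarrow> adm X Y (fn k)"
proof
  assume "admissible V U X Y k"
  then show "adm X Y (fn k)"
    by (auto simp: admissible_def adm_def)
next
  assume "adm X Y (fn k)"
  then obtain m where m: "m \<in> hom V X Y" "\<forall>x\<in>FO U X. act m x = fn k x"
    by (auto simp: adm_def)
  have k: "k = (FO U X, fn k, FO U Y)" "fn k \<in> FO U X \<rightarrow>\<^sub>E FO U Y"
    using assms(3) by (auto simp: set_hom_iff)
  have "act m = fn k"
    using PiE_ext[OF FA_hom(2)[OF m(1)] k(2)] m(2) by blast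
  then show "admissible V U X Y k"
    using FA_hom(1)[OF m(1)] k(1) m(1) by (auto simp: admissible_def)
qed

lemma adm_amnestic:
  assumes "FO U X = FO U Y" "adm X Y (\<lambda>x. x)" "adm Y X (\<lambda>x. x)"
  shows "X = Y"
proof (rule amnestic)
  show ob: "X \<in> Ob V" "Y \<in> Ob V"
    using assms(2) adm_ob by auto
  have "Idn (Set_cat \<U>) (FO U X) = (FO U X, restrict (\<lambda>x. x) (FO U X), FO U X)"
    by (simp add: Set_cat_def)
  moreover have "\<dots> \<in> hom (Set_cat \<U>) (FO U X) (FO U X)"
    using ob by (intro set_homI FO_small) auto
  ultimately have id: "Idn (Set_cat \<U>) (FO U X) \<in> hom (Set_cat \<U>) (FO U X) (FO U X)"
    "fn (Idn (Set_cat \<U>) (FO U X)) = restrict (\<lambda>x. x) (FO U X)"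
    by (simp_all add: fn_def)
  have "adm X Y (restrict (\<lambda>x. x) (FO U X))" "adm Y X (restrict (\<lambda>x. x) (FO U X))"
    using assms(1) by (auto intro: adm_cong[OF assms(2)] adm_cong[OF assms(3)])
  then show "admissible V U X Y (Idn (Set_cat \<U>) (FO U X))"
    "admissible V U Y X (Idn (Set_cat \<U>) (FO U X))"
    using ob id(1) by (simp_all add: admissible_iff assms(1) id(2)[unfolded assms(1)])
qed (use assms in auto)

text \<open>Initial lifts for sources of bare functions. The set \<open>K\<close> may be large, and
  its functions are arbitrary outside \<open>Z\<close>.\<close>

lemma initial_lift_adm:
  assumes Z: "Z \<in> small_sets \<U>"
    and K: "\<And>Y k. (Y, k) \<in> K \<Longrightarrow> Y \<in> Ob V \<and> k \<in> Z \<rightarrow> FO U Y"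
  obtains X where "X \<in> Ob V" "FO U X = Z" "\<And>Y k. (Y, k) \<in> K \<Longrightarrow> adm X Y k"
    "\<And>W h. W \<in> Ob V \<Longrightarrow> h \<in> FO U W \<rightarrow> Z \<Longrightarrow> (\<And>Y k. (Y, k) \<in> K \<Longrightarrow> adm W Y (\<lambda>x. k (h x))) \<Longrightarrow> adm W X h"
proof -
  \<comment> \<open>Arrows of \<open>Set_cat\<close> carry extensional functions, so every leg is
    cut down to \<open>Z\<close> before the lift is taken.\<close>
  define K' where "K' = (\<lambda>(Y, k). (Y, (Z, restrict k Z, FO U Y))) ` K"
  have "Z \<in> Ob (Set_cat \<U>)"
    using Z by (simp add: Set_cat_def)
  moreover have K': "Y \<in> Ob V \<and> k \<in> hom (Set_cat \<U>) Z (FO U Y)" if "(Y, k) \<in> K'" for Y k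
    using that K Z by (force simp: K'_def intro!: set_homI FO_small)
  ultimately obtain X where X: "X \<in> Ob V" "FO U X = Z" "\<forall>(Y, k) \<in> K'. admissible V U X Y k"
    "initial_source V (Set_cat \<U>) U X K'"
    using initial_lift by metis
  show ?thesis
  proof
    show "adm X Y k" if "(Y, k) \<in> K" for Y k
    proof -
      have "(Y, (Z, restrict k Z, FO U Y)) \<in> K'"
        using that by (force simp: K'_def)
      then have "adm X Y (restrict k Z)"
        using X K' admissible_iff[OF X(1)] by (fastforce simp: fn_def)
      then show ?thesis
        by (rule adm_cong) (simp add: X)
    qed
    show "adm W X h" if W: "W \<in> Ob V" "h \<in> FO U W \<rightarrow> Z"
      and h: "\<And>Y k. (Y, k) \<in> K \<Longrightarrow> adm W Y (\<lambda>x. k (h x))" for W h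
    proof -
      let ?h = "(FO U W, restrict h (FO U W), FO U X)"
      have hom: "?h \<in> hom (Set_cat \<U>) (FO U W) (FO U X)"
        using W X by (intro set_homI FO_small) auto
      have "admissible V U W Y (Cmp (Set_cat \<U>) k ?h)" if "(Y, k) \<in> K'" for Y k
      proof -
        obtain k0 where k0: "(Y, k0) \<in> K" "k = (Z, restrict k0 Z, FO U Y)"
          using \<open>(Y, k) \<in> K'\<close> by (auto simp: K'_def)
        have eq: "Cmp (Set_cat \<U>) k ?h = (FO U W, restrict (\<lambda>x. k0 (h x)) (FO U W), FO U Y)"
          using W(2) by (auto simp: k0(2) compose_def fun_eq_iff restrict_def)
        have "(\<lambda>x. k0 (h x)) \<in> FO U W \<rightarrow> FO U Y"
          using K[OF k0(1)] W(2) by auto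
        then have hom': "Cmp (Set_cat \<U>) k ?h \<in> hom (Set_cat \<U>) (FO U W) (FO U Y)"
          unfolding eq using W(1) K[OF k0(1)] by (intro set_homI FO_small) auto
        have "adm W Y (restrict (\<lambda>x. k0 (h x)) (FO U W))"
          using h[OF k0(1)] by (rule adm_cong) simp
        then show ?thesis
          using admissible_iff[OF W(1) _ hom'] K[OF k0(1)] by (simp add: eq fn_def)
      qed
      then have "admissible V U W X ?h"
        using X(4) W(1) hom unfolding initial_source_def by blast
      then have "adm W X (restrict h (FO U W))"
        using admissible_iff[OF W(1) X(1) hom] by (simp add: fn_def)
      then show ?thesis
        by (rule adm_cong) simp
    qed
  qed (use X in auto)
qed

end

section \<open>Products\<close>

context topological_setting
begin

text \<open>The predicate under the \<open>THE\<close> of \<open>prod_cone\<close>, isolated so that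
  existence and uniqueness can be proved separately.\<close>

definition is_std_cone :: "'v list \<Rightarrow> 'v \<times> 'm list \<Rightarrow> bool" where
  "is_std_cone Xs c \<longleftrightarrow> is_product V Xs (fst c) (snd c) \<and>
     FO U (fst c) = tuples \<U> (map (FO U) Xs) \<and>
     (\<forall>i < length Xs. FA U (snd c ! i) = set_proj \<U> (map (FO U) Xs) i)"

lemma std_coneD:
  assumes "is_std_cone Xs c"
  shows "fst c \<in> Ob V" "length (snd c) = length Xs" "FO U (fst c) = tuples \<U> (map (FO U) Xs)"
    and "i < length Xs \<Longrightarrow> snd c ! i \<in> hom V (fst c) (Xs ! i)"
    and "i < length Xs \<Longrightarrow> z \<in> FO U (fst c) \<Longrightarrow> act (snd c ! i) z = tup_nth \<U> i z"
  using assms by (auto simp: is_std_cone_def is_product_def set_proj_def fn_def)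

lemma std_cone_universal:
  assumes c: "is_std_cone Xs c" and W: "W \<in> Ob V"
    and g: "\<And>i. i < length Xs \<Longrightarrow> g i \<in> hom V W (Xs ! i)"
  shows "\<exists>!m. m \<in> hom V W (fst c) \<and> (\<forall>i < length Xs. Cmp V (snd c ! i) m = g i)"
proof -
  let ?fs = "map g [0..<length Xs]"
  have "length ?fs = length Xs \<and> (\<forall>i < length Xs. ?fs ! i \<in> hom V W (Xs ! i))"
    using g by simp
  then have "\<exists>!m. m \<in> hom V W (fst c) \<and> (\<forall>i < length Xs. Cmp V (snd c ! i) m = ?fs ! i)"
    using c W unfolding is_std_cone_def is_product_def by blast
  moreover have "(\<forall>i < length Xs. Cmp V (snd c ! i) m = ?fs ! i) \<longleftrightarrow>
      (\<forall>i < length Xs. Cmp V (snd c ! i) m = g i)" for m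
    by simp
  ultimately show ?thesis
    by (simp only:)
qed

text \<open>The universal property lifts the coordinates of \<open>h\<close> to a single morphism,
  which acts as \<open>h\<close> because a tuple is determined by its coordinates. It holds for
  every standard cone, whatever its construction, so that two cones can be compared.\<close>

lemma std_cone_adm:
  assumes c: "is_std_cone Xs c" and W: "W \<in> Ob V" and h: "h \<in> FO U W \<rightarrow> tuples \<U> (map (FO U) Xs)"
    and comp: "\<And>i. i < length Xs \<Longrightarrow> adm W (Xs ! i) (\<lambda>w. tup_nth \<U> i (h w))"
  shows "adm W (fst c) h"
proof -
  obtain g where g: "\<And>i. i < length Xs \<Longrightarrow> g i \<in> hom V W (Xs ! i)"
    "\<And>i w. i < length Xs \<Longrightarrow> w \<in> FO U W \<Longrightarrow> act (g i) w = tup_nth \<U> i (h w)"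
    using comp unfolding adm_def by metis
  obtain m where m: "m \<in> hom V W (fst c)" "\<And>i. i < length Xs \<Longrightarrow> Cmp V (snd c ! i) m = g i"
    using std_cone_universal[OF c W g(1)] by blast
  have "act m w = h w" if w: "w \<in> FO U W" for w
  proof (rule tuples_eqI)
    show "act m w \<in> tuples \<U> (map (FO U) Xs)"
      using act_in[OF m(1) w] std_coneD(3)[OF c] by simp
    show "h w \<in> tuples \<U> (map (FO U) Xs)"
      using h w by auto
    show "tup_nth \<U> i (act m w) = tup_nth \<U> i (h w)" if "i < length (map (FO U) Xs)" for i
      using act_comp[OF m(1) std_coneD(4)[OF c] w] m(2) g(2) w that
        std_coneD(5)[OF c _ act_in[OF m(1) w]] by simp
  qed
  then show ?thesis
    using m(1) by (auto simp: adm_def)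
qed

text \<open>The set of tuples gets the initial structure for its coordinate functions. Initiality
  makes the tupling of any cone admissible, and coordinates determine the mediating
  morphism.\<close>

lemma std_cone_exists:
  assumes "set Xs \<subseteq> Ob V"
  shows "\<exists>c. is_std_cone Xs c"
proof -
  let ?Z = "tuples \<U> (map (FO U) Xs)"
  let ?K = "(\<lambda>i. (Xs ! i, tup_nth \<U> i)) ` {..<length Xs}"
  have "?Z \<in> small_sets \<U>"
    using assms FO_small by (intro small_tuples) auto
  then obtain X where X: "X \<in> Ob V" "FO U X = ?Z" "\<And>Y k. (Y, k) \<in> ?K \<Longrightarrow> adm X Y k"
    "\<And>W h. W \<in> Ob V \<Longrightarrow> h \<in> FO U W \<rightarrow> ?Z \<Longrightarrow>
      (\<And>Y k. (Y, k) \<in> ?K \<Longrightarrow> adm W Y (\<lambda>x. k (h x))) \<Longrightarrow> adm W X h"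
    using assms by (elim initial_lift_adm[where K = ?K]) (auto dest: tup_nth_in)
  have "\<forall>i<length Xs. \<exists>m \<in> hom V X (Xs ! i). \<forall>z \<in> ?Z. act m z = tup_nth \<U> i z"
    using X(2,3) by (auto simp: adm_def)
  then obtain p where p: "\<And>i. i < length Xs \<Longrightarrow> p i \<in> hom V X (Xs ! i)"
    "\<And>i z. i < length Xs \<Longrightarrow> z \<in> ?Z \<Longrightarrow> act (p i) z = tup_nth \<U> i z"
    by metis
  let ?ps = "map p [0..<length Xs]"
  have "\<exists>!h. h \<in> hom V W X \<and> (\<forall>i < length Xs. Cmp V (?ps ! i) h = fs ! i)"
    if W: "W \<in> Ob V" and fs: "\<And>i. i < length Xs \<Longrightarrow> fs ! i \<in> hom V W (Xs ! i)" for W fs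
  proof -
    define h where "h w = tup \<U> (map (\<lambda>i. act (fs ! i) w) [0..<length Xs])" for w
    have "h \<in> FO U W \<rightarrow> ?Z"
      using act_in[OF fs] by (auto simp: h_def in_listset_conv_nth intro!: tup_in_tuples)
    moreover have "adm W Y (\<lambda>x. k (h x))" if "(Y, k) \<in> ?K" for Y k
      using that by (auto simp: h_def intro!: adm_cong[OF adm_hom[OF fs]])
    ultimately have "adm W X h"
      using X(4) W by blast
    then obtain m where m: "m \<in> hom V W X" "\<forall>w\<in>FO U W. act m w = h w"
      by (auto simp: adm_def)
    have "Cmp V (?ps ! i) m = fs ! i" if i: "i < length Xs" for i
    proof (rule hom_eqI)
      show "Cmp V (?ps ! i) m \<in> hom V W (Xs ! i)"
        using C.comp_hom[OF m(1) p(1)] i by simp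
      show "fs ! i \<in> hom V W (Xs ! i)"
        by (rule fs[OF i])
      show "act (Cmp V (?ps ! i) m) w = act (fs ! i) w" if w: "w \<in> FO U W" for w
        using act_comp[OF m(1) p(1)[OF i] w] p(2)[OF i, of "act m w"] act_in[OF m(1) w] X(2) m(2) w i
        by (simp add: h_def)
    qed
    moreover have "m' = m"
      if m': "m' \<in> hom V W X" "\<forall>i < length Xs. Cmp V (?ps ! i) m' = fs ! i" for m'
    proof (rule hom_eqI[OF m'(1) m(1)])
      fix w assume w: "w \<in> FO U W"
      show "act m' w = act m w"
      proof (rule tuples_eqI)
        show "act m' w \<in> ?Z" "act m w \<in> ?Z"
          using act_in[OF m'(1) w] act_in[OF m(1) w] X(2) by auto
        show "tup_nth \<U> i (act m' w) = tup_nth \<U> i (act m w)" if "i < length (map (FO U) Xs)" for i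
          using that act_comp[OF m'(1) p(1) w, of i] p(2)[of i "act m' w"] act_in[OF m'(1) w]
            X(2) m(2) w m'(2) by (simp add: h_def)
      qed
    qed
    ultimately show ?thesis
      using m(1) by blast
  qed
  then have "is_product V Xs X ?ps"
    using X(1) p(1) by (auto simp: is_product_def)
  moreover have "FA U (?ps ! i) = set_proj \<U> (map (FO U) Xs) i" if i: "i < length Xs" for i
  proof -
    have "act (p i) = restrict (tup_nth \<U> i) ?Z"
      using FA_hom(2)[OF p(1)[OF i]] p(2)[OF i] X(2) by (auto simp: fun_eq_iff restrict_def PiE_def extensional_def)
    then show ?thesis
      using FA_hom(1)[OF p(1)[OF i]] i X(2) by (simp add: set_proj_def)
  qed
  ultimately have "is_std_cone Xs (X, ?ps)"
    using X(2) by (simp add: is_std_cone_def)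
  then show ?thesis ..
qed

text \<open>The identity on tuples is admissible in both directions, so amnesticity gives equality
  of the objects and not just an isomorphism. The projections then agree because they act
  alike.\<close>

lemma std_cone_unique:
  assumes c: "is_std_cone Xs c" and d: "is_std_cone Xs d"
  shows "c = d"
proof -
  have adm: "adm (fst c') (fst d') (\<lambda>x. x)" if c': "is_std_cone Xs c'" and d': "is_std_cone Xs d'" for c' d'
    by (rule std_cone_adm[OF d'])
      (auto simp: std_coneD[OF c'] intro: adm_cong[OF adm_hom[OF std_coneD(4)[OF c']]])
  have fst: "fst c = fst d"
    by (rule adm_amnestic) (simp_all add: std_coneD[OF c] std_coneD[OF d] adm c d)
  have "snd c ! i = snd d ! i" if i: "i < length Xs" for i
    by (rule hom_eqI[OF std_coneD(4)[OF c i]])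
      (use std_coneD(4,5)[OF d i] std_coneD(5)[OF c i] fst in auto)
  then have "snd c = snd d"
    using std_coneD(2)[OF c] std_coneD(2)[OF d] by (auto intro: nth_equalityI)
  with fst show ?thesis
    by (simp add: prod_eq_iff)
qed

lemma is_std_cone_prod_cone: "set Xs \<subseteq> Ob V \<Longrightarrow> is_std_cone Xs (prod_cone \<U> V U Xs)"
  unfolding prod_cone_def is_std_cone_def[symmetric]
  using std_cone_exists std_cone_unique by (metis theI)

lemma prodO_ob: "set Xs \<subseteq> Ob V \<Longrightarrow> prodO \<U> V U Xs \<in> Ob V"
  unfolding prodO_def by (rule std_coneD(1)[OF is_std_cone_prod_cone])

lemma FO_prodO: "set Xs \<subseteq> Ob V \<Longrightarrow> FO U (prodO \<U> V U Xs) = tuples \<U> (map (FO U) Xs)"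
  unfolding prodO_def by (rule std_coneD(3)[OF is_std_cone_prod_cone])

lemma prodP_hom:
  "set Xs \<subseteq> Ob V \<Longrightarrow> i < length Xs \<Longrightarrow> prodP \<U> V U Xs i \<in> hom V (prodO \<U> V U Xs) (Xs ! i)"
  unfolding prodO_def prodP_def by (rule std_coneD(4)[OF is_std_cone_prod_cone])

lemma act_prodP:
  "set Xs \<subseteq> Ob V \<Longrightarrow> i < length Xs \<Longrightarrow> z \<in> FO U (prodO \<U> V U Xs) \<Longrightarrow>
     act (prodP \<U> V U Xs i) z = tup_nth \<U> i z"
  unfolding prodO_def prodP_def by (rule std_coneD(5)[OF is_std_cone_prod_cone])

lemma adm_prodP:
  "set Xs \<subseteq> Ob V \<Longrightarrow> i < length Xs \<Longrightarrow> adm (prodO \<U> V U Xs) (Xs ! i) (tup_nth \<U> i)"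
  by (rule adm_cong[OF adm_hom[OF prodP_hom]]) (auto simp: act_prodP)

lemma adm_prodI:
  assumes "set Xs \<subseteq> Ob V" "W \<in> Ob V" "length hs = length Xs"
    and "\<And>i. i < length Xs \<Longrightarrow> adm W (Xs ! i) (hs ! i)"
  shows "adm W (prodO \<U> V U Xs) (\<lambda>w. tup \<U> (map (\<lambda>h. h w) hs))"
  unfolding prodO_def
  by (rule std_cone_adm[OF is_std_cone_prod_cone])
    (use assms adm_in[OF assms(4)] in \<open>auto simp: in_listset_conv_nth intro!: tup_in_tuples intro: adm_cong\<close>)

lemma prodA_spec:
  assumes f: "\<And>S. S \<in> set Ss \<Longrightarrow> f S \<in> hom V (X S) (Y S)"
  shows prodA_hom: "prodA \<U> V U (map f Ss) \<in> hom V (prodO \<U> V U (map X Ss)) (prodO \<U> V U (map Y Ss))"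
    and act_prodA: "xs \<in> listset (map (\<lambda>S. FO U (X S)) Ss) \<Longrightarrow>
      act (prodA \<U> V U (map f Ss)) (tup \<U> xs) = tup \<U> (map2 (\<lambda>S. act (f S)) Ss xs)"
proof -
  \<comment> \<open>\<open>prodA\<close> reads its product objects off its arrows; these equations
    replace them by \<open>X\<close> and \<open>Y\<close>, after which the universal property
    supplies the unique existence that its \<open>THE\<close> asks for.\<close>
  have dom: "map (Dom V) (map f Ss) = map X Ss" and cod: "map (Cod V) (map f Ss) = map Y Ss"
    using f by (auto simp: hom_def)
  have X: "set (map X Ss) \<subseteq> Ob V" and Y: "set (map Y Ss) \<subseteq> Ob V"
    using hom_ob[OF f] by auto
  let ?P = "\<lambda>h. h \<in> hom V (prodO \<U> V U (map X Ss)) (prodO \<U> V U (map Y Ss)) \<and>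
    (\<forall>i < length Ss. Cmp V (prodP \<U> V U (map Y Ss) i) h = Cmp V (f (Ss ! i)) (prodP \<U> V U (map X Ss) i))"
  have "Cmp V (f (Ss ! i)) (prodP \<U> V U (map X Ss) i) \<in> hom V (prodO \<U> V U (map X Ss)) (Y (Ss ! i))"
    if "i < length Ss" for i
    by (rule C.comp_hom[of _ _ "X (Ss ! i)"]) (use prodP_hom[OF X, of i] f that in auto)
  then have "\<exists>!h. ?P h"
    using std_cone_universal[OF is_std_cone_prod_cone[OF Y] prodO_ob[OF X],
        of "\<lambda>i. Cmp V (f (Ss ! i)) (prodP \<U> V U (map X Ss) i)"]
    by (simp add: prodP_def prodO_def)
  from theI'[OF this] have P: "?P (prodA \<U> V U (map f Ss))"
    unfolding prodA_def dom cod by simp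
  then show hom: "prodA \<U> V U (map f Ss) \<in> hom V (prodO \<U> V U (map X Ss)) (prodO \<U> V U (map Y Ss))"
    by blast
  assume xs: "xs \<in> listset (map (\<lambda>S. FO U (X S)) Ss)"
  then have z: "tup \<U> xs \<in> FO U (prodO \<U> V U (map X Ss))"
    using FO_prodO[OF X] by (simp add: comp_def)
  have len: "length xs = length Ss"
    using xs by (simp add: in_listset_conv_nth)
  show "act (prodA \<U> V U (map f Ss)) (tup \<U> xs) = tup \<U> (map2 (\<lambda>S. act (f S)) Ss xs)"
  proof (rule tuples_eqI)
    let ?B = "map (FO U) (map Y Ss)"
    show in_Y: "act (prodA \<U> V U (map f Ss)) (tup \<U> xs) \<in> tuples \<U> ?B"
      using act_in[OF hom z] FO_prodO[OF Y] by simp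
    show "tup \<U> (map2 (\<lambda>S. act (f S)) Ss xs) \<in> tuples \<U> ?B"
      using xs act_in[OF f] by (intro tup_in_tuples) (auto simp: in_listset_conv_nth)
    show "tup_nth \<U> i (act (prodA \<U> V U (map f Ss)) (tup \<U> xs)) =
      tup_nth \<U> i (tup \<U> (map2 (\<lambda>S. act (f S)) Ss xs))" if "i < length ?B" for i
    proof -
      have i: "i < length Ss"
        using that by simp
      have "tup_nth \<U> i (act (prodA \<U> V U (map f Ss)) (tup \<U> xs)) =
        act (Cmp V (prodP \<U> V U (map Y Ss) i) (prodA \<U> V U (map f Ss))) (tup \<U> xs)"
        using act_comp[OF hom prodP_hom[OF Y] z] act_prodP[OF Y _ act_in[OF hom z]] i by simp
      also have "\<dots> = act (Cmp V (f (Ss ! i)) (prodP \<U> V U (map X Ss) i)) (tup \<U> xs)"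
        using P i by simp
      also have "\<dots> = act (f (Ss ! i)) (act (prodP \<U> V U (map X Ss) i) (tup \<U> xs))"
        by (rule act_comp[of _ _ "X (Ss ! i)" _ "Y (Ss ! i)"]) (use prodP_hom[OF X, of i] f z i in auto)
      also have "\<dots> = act (f (Ss ! i)) (xs ! i)"
        using act_prodP[OF X _ z] i len by simp
      finally show ?thesis
        using i len by simp
    qed
  qed
qed

end

section \<open>Enriched algebras\<close>

lemma restrict_eq_iff: "restrict f A = restrict g A \<longleftrightarrow> (\<forall>x\<in>A. f x = g x)"
  by (auto simp: fun_eq_iff restrict_def)

lemma und_sig_simps [simp]:
  "Ops (und_sig U \<Sigma>) = (SIGMA \<sigma> : Ops \<Sigma>. FO U (Par \<Sigma> \<sigma>))"
  "Ins (und_sig U \<Sigma>) (\<sigma>, p) = Ins \<Sigma> \<sigma>"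
  "Out (und_sig U \<Sigma>) (\<sigma>, p) = Out \<Sigma> \<sigma>"
  by (simp_all add: und_sig_def)

lemma param_power_simps [simp]:
  "FO (param_power \<U> V U P Ss) A = P \<otimes>\<^bsub>V\<^esub> prodO \<U> V U (map (Carr A) Ss)"
  "FA (param_power \<U> V U P Ss) (A, f, B) = Idn V P \<boxtimes>\<^bsub>V\<^esub> prodA \<U> V U (map f Ss)"
  by (simp_all add: param_power_def)

lemma carrier_at_simps [simp]:
  "FO (carrier_at S) A = Carr A S" "FA (carrier_at S) (A, f, B) = f S"
  by (simp_all add: carrier_at_def)

locale enriched_setting = topological_setting \<U> V U
  for \<U> :: "'u universe" and V :: "('v, 'm) smcat"
    and U :: "('v, 'm, 'u set, 'u set_arr) fctr" +
  fixes \<S> :: "'s set" and \<Sigma> :: "('op, 's, 'v) esig"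
  assumes signature: "enriched_signature \<U> V \<S> \<Sigma>"
begin

abbreviation algs :: "('op, 's, 'v, 'm) alg set" where
  "algs \<equiv> algebras \<U> V U \<S> \<Sigma>"

abbreviation args :: "('op, 's, 'v, 'm) alg \<Rightarrow> 's list \<Rightarrow> 'u list set" where
  "args A Ss \<equiv> listset (map (\<lambda>S. FO U (Carr A S)) Ss)"

abbreviation args_ob :: "'v \<Rightarrow> ('op, 's, 'v, 'm) alg \<Rightarrow> 's list \<Rightarrow> 'v" where
  "args_ob P A Ss \<equiv> P \<otimes>\<^bsub>V\<^esub> prodO \<U> V U (map (Carr A) Ss)"

abbreviation opn :: "('op, 's, 'v, 'm) alg \<Rightarrow> 'op \<Rightarrow> 'u \<Rightarrow> 'u list \<Rightarrow> 'u" where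
  "opn A \<sigma> p xs \<equiv> act (Intp A \<sigma>) (enc \<U> (p, tup \<U> xs))"

abbreviation und :: "('op, 's, 'v, 'm) alg \<Rightarrow> ('op \<times> 'u, 's, 'u) calg" where
  "und \<equiv> und_alg \<U> U \<S> \<Sigma>"

lemma sig_sorts: "\<sigma> \<in> Ops \<Sigma> \<Longrightarrow> set (Ins \<Sigma> \<sigma>) \<subseteq> \<S>" "\<sigma> \<in> Ops \<Sigma> \<Longrightarrow> Out \<Sigma> \<sigma> \<in> \<S>"
  and Par_ob: "\<sigma> \<in> Ops \<Sigma> \<Longrightarrow> Par \<Sigma> \<sigma> \<in> Ob V"
  using signature by (auto simp: enriched_signature_def)

lemma Carr_ob: "A \<in> algs \<Longrightarrow> S \<in> \<S> \<Longrightarrow> Carr A S \<in> Ob V"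
  by (auto simp: algebras_def)

lemma Carrs_ob: "A \<in> algs \<Longrightarrow> set Ss \<subseteq> \<S> \<Longrightarrow> set (map (Carr A) Ss) \<subseteq> Ob V"
  using Carr_ob by auto

lemma Intp_hom:
  "A \<in> algs \<Longrightarrow> \<sigma> \<in> Ops \<Sigma> \<Longrightarrow> Intp A \<sigma> \<in> hom V (args_ob (Par \<Sigma> \<sigma>) A (Ins \<Sigma> \<sigma>)) (Carr A (Out \<Sigma> \<sigma>))"
  by (auto simp: algebras_def)

lemma args_ob_ob: "A \<in> algs \<Longrightarrow> set Ss \<subseteq> \<S> \<Longrightarrow> P \<in> Ob V \<Longrightarrow> args_ob P A Ss \<in> Ob V"
  using prodO_ob[OF Carrs_ob] M.ten_ob by blast

lemma FO_args_ob:
  assumes "A \<in> algs" "set Ss \<subseteq> \<S>" "P \<in> Ob V"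
  shows "FO U (args_ob P A Ss) = (\<lambda>(p, xs). enc \<U> (p, tup \<U> xs)) ` (FO U P \<times> args A Ss)"
proof -
  note Cs = Carrs_ob[OF assms(1,2)]
  have "FO U (args_ob P A Ss) = enc \<U> ` (FO U P \<times> tup \<U> ` args A Ss)"
    by (simp add: FO_ten[OF assms(3) prodO_ob[OF Cs]] FO_prodO[OF Cs] set_prod_def tuples_def comp_def)
  then show ?thesis
    by force
qed

lemma opn_in:
  assumes "A \<in> algs" "\<sigma> \<in> Ops \<Sigma>" "p \<in> FO U (Par \<Sigma> \<sigma>)" "xs \<in> args A (Ins \<Sigma> \<sigma>)"
  shows "opn A \<sigma> p xs \<in> FO U (Carr A (Out \<Sigma> \<sigma>))"
  by (rule act_in[OF Intp_hom]) (use assms in \<open>auto simp: FO_args_ob sig_sorts Par_ob\<close>)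

lemma args_ob_eqI:
  assumes "A \<in> algs" "set Ss \<subseteq> \<S>" "P \<in> Ob V"
    and "m \<in> hom V (args_ob P A Ss) Y" "n \<in> hom V (args_ob P A Ss) Y"
    and "\<And>p xs. p \<in> FO U P \<Longrightarrow> xs \<in> args A Ss \<Longrightarrow>
      act m (enc \<U> (p, tup \<U> xs)) = act n (enc \<U> (p, tup \<U> xs))"
  shows "m = n"
  by (rule hom_eqI[OF assms(4,5)]) (use assms(1-3,6) in \<open>auto simp: FO_args_ob\<close>)

lemma
  assumes "A \<in> algs" "set Ss \<subseteq> \<S>" "P \<in> Ob V"
    and f: "\<And>S. S \<in> set Ss \<Longrightarrow> f S \<in> hom V (Carr A S) (Carr B S)"
  shows args_map_hom:
      "Idn V P \<boxtimes>\<^bsub>V\<^esub> prodA \<U> V U (map f Ss) \<in> hom V (args_ob P A Ss) (args_ob P B Ss)"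
    and act_args_map: "p \<in> FO U P \<Longrightarrow> xs \<in> args A Ss \<Longrightarrow>
      act (Idn V P \<boxtimes>\<^bsub>V\<^esub> prodA \<U> V U (map f Ss)) (enc \<U> (p, tup \<U> xs)) =
      enc \<U> (p, tup \<U> (map2 (\<lambda>S. act (f S)) Ss xs))"
proof -
  have hom: "prodA \<U> V U (map f Ss) \<in> hom V (prodO \<U> V U (map (Carr A) Ss)) (prodO \<U> V U (map (Carr B) Ss))"
    by (rule prodA_hom) (rule f)
  have id: "Idn V P \<in> hom V P P"
    by (rule C.id_hom) (rule assms)
  show "Idn V P \<boxtimes>\<^bsub>V\<^esub> prodA \<U> V U (map f Ss) \<in> hom V (args_ob P A Ss) (args_ob P B Ss)"
    by (rule M.ten_hom[OF id hom])
  assume p: "p \<in> FO U P" and xs: "xs \<in> args A Ss"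
  have z: "tup \<U> xs \<in> FO U (prodO \<U> V U (map (Carr A) Ss))"
    using xs FO_prodO[OF Carrs_ob[OF assms(1,2)]] by (simp add: comp_def)
  show "act (Idn V P \<boxtimes>\<^bsub>V\<^esub> prodA \<U> V U (map f Ss)) (enc \<U> (p, tup \<U> xs)) =
      enc \<U> (p, tup \<U> (map2 (\<lambda>S. act (f S)) Ss xs))"
    using act_ten[OF id hom p z] act_id[OF assms(3) p] act_prodA[OF f xs] by simp
qed

lemma map2_args:
  assumes "xs \<in> args A Ss" "\<And>S. S \<in> set Ss \<Longrightarrow> f S \<in> hom V (Carr A S) (Carr B S)"
  shows "map2 (\<lambda>S. act (f S)) Ss xs \<in> args B Ss"
  using assms(1) act_in[OF assms(2)] by (auto simp: in_listset_conv_nth)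

text \<open>Both sides of the homomorphism square are arrows out of \<open>args_ob\<close>, where
  \<open>args_ob_eqI\<close> tests equality on elements. All later work with homomorphisms uses this
  elementwise form.\<close>

lemma alg_arr_iff:
  "(A, f, B) \<in> alg_arrs \<U> V U \<S> \<Sigma> \<longleftrightarrow>
     A \<in> algs \<and> B \<in> algs \<and> f \<in> (\<Pi>\<^sub>E S\<in>\<S>. hom V (Carr A S) (Carr B S)) \<and>
     (\<forall>\<sigma>\<in>Ops \<Sigma>. \<forall>p\<in>FO U (Par \<Sigma> \<sigma>). \<forall>xs\<in>args A (Ins \<Sigma> \<sigma>).
        act (f (Out \<Sigma> \<sigma>)) (opn A \<sigma> p xs) = opn B \<sigma> p (map2 (\<lambda>S. act (f S)) (Ins \<Sigma> \<sigma>) xs))"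
proof -
  have "Cmp V (f (Out \<Sigma> \<sigma>)) (Intp A \<sigma>) =
        Cmp V (Intp B \<sigma>) (Idn V (Par \<Sigma> \<sigma>) \<boxtimes>\<^bsub>V\<^esub> prodA \<U> V U (map f (Ins \<Sigma> \<sigma>))) \<longleftrightarrow>
      (\<forall>p\<in>FO U (Par \<Sigma> \<sigma>). \<forall>xs\<in>args A (Ins \<Sigma> \<sigma>).
        act (f (Out \<Sigma> \<sigma>)) (opn A \<sigma> p xs) = opn B \<sigma> p (map2 (\<lambda>S. act (f S)) (Ins \<Sigma> \<sigma>) xs))"
    (is "?l = ?r \<longleftrightarrow> ?Q")
    if A: "A \<in> algs" and B: "B \<in> algs" and f: "f \<in> (\<Pi>\<^sub>E S\<in>\<S>. hom V (Carr A S) (Carr B S))" and \<sigma>: "\<sigma> \<in> Ops \<Sigma>"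
    for \<sigma>
  proof -
    have hom: "f S \<in> hom V (Carr A S) (Carr B S)" if "S \<in> \<S>" for S
      using f that by auto
    have homs: "f S \<in> hom V (Carr A S) (Carr B S)" if "S \<in> set (Ins \<Sigma> \<sigma>)" for S
      using hom that sig_sorts(1)[OF \<sigma>] by auto
    note pw = A sig_sorts(1)[OF \<sigma>] Par_ob[OF \<sigma>]
    have l: "?l \<in> hom V (args_ob (Par \<Sigma> \<sigma>) A (Ins \<Sigma> \<sigma>)) (Carr B (Out \<Sigma> \<sigma>))"
      by (rule C.comp_hom[OF Intp_hom[OF A \<sigma>] hom[OF sig_sorts(2)[OF \<sigma>]]])
    have r: "?r \<in> hom V (args_ob (Par \<Sigma> \<sigma>) A (Ins \<Sigma> \<sigma>)) (Carr B (Out \<Sigma> \<sigma>))"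
      by (rule C.comp_hom[OF args_map_hom[OF pw homs] Intp_hom[OF B \<sigma>]])
    have act_l: "act ?l (enc \<U> (p, tup \<U> xs)) = act (f (Out \<Sigma> \<sigma>)) (opn A \<sigma> p xs)"
      and act_r: "act ?r (enc \<U> (p, tup \<U> xs)) = opn B \<sigma> p (map2 (\<lambda>S. act (f S)) (Ins \<Sigma> \<sigma>) xs)"
      if p: "p \<in> FO U (Par \<Sigma> \<sigma>)" and xs: "xs \<in> args A (Ins \<Sigma> \<sigma>)" for p xs
    proof -
      have z: "enc \<U> (p, tup \<U> xs) \<in> FO U (args_ob (Par \<Sigma> \<sigma>) A (Ins \<Sigma> \<sigma>))"
        using p xs by (auto simp: FO_args_ob pw)
      show "act ?l (enc \<U> (p, tup \<U> xs)) = act (f (Out \<Sigma> \<sigma>)) (opn A \<sigma> p xs)"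
        by (rule act_comp[OF Intp_hom[OF A \<sigma>] hom[OF sig_sorts(2)[OF \<sigma>]] z])
      show "act ?r (enc \<U> (p, tup \<U> xs)) = opn B \<sigma> p (map2 (\<lambda>S. act (f S)) (Ins \<Sigma> \<sigma>) xs)"
        using act_comp[OF args_map_hom[OF pw homs] Intp_hom[OF B \<sigma>] z]
        by (simp add: act_args_map[OF pw homs p xs])
    qed
    show ?thesis
    proof
      assume eq: "?l = ?r"
      show ?Q
      proof (intro ballI)
        fix p xs assume "p \<in> FO U (Par \<Sigma> \<sigma>)" "xs \<in> args A (Ins \<Sigma> \<sigma>)"
        from act_l[OF this] act_r[OF this]
        show "act (f (Out \<Sigma> \<sigma>)) (opn A \<sigma> p xs) = opn B \<sigma> p (map2 (\<lambda>S. act (f S)) (Ins \<Sigma> \<sigma>) xs)"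
          unfolding eq by simp
      qed
    next
      assume ?Q
      then show "?l = ?r"
        using act_l act_r by (intro args_ob_eqI[OF pw l r]) simp
    qed
  qed
  then show ?thesis
    unfolding alg_arrs_def by auto
qed

section \<open>The category of algebras and the functors between which operations are
  natural\<close>

lemma hom_Alg:
  "m \<in> hom (Alg_cat \<U> V U \<S> \<Sigma>) A B \<longleftrightarrow> (\<exists>f. m = (A, f, B) \<and> (A, f, B) \<in> alg_arrs \<U> V U \<S> \<Sigma>)"
  by (cases m) (auto simp: hom_def Alg_cat_def)

lemma Alg_cat_simps [simp]:
  "Ob (Alg_cat \<U> V U \<S> \<Sigma>) = algs"
  "Idn (Alg_cat \<U> V U \<S> \<Sigma>) A = (A, \<lambda>S\<in>\<S>. Idn V (Carr A S), A)"
  "Cmp (Alg_cat \<U> V U \<S> \<Sigma>) (B', g, C) (A, f, B) = (A, \<lambda>S\<in>\<S>. Cmp V (g S) (f S), C)"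
  by (simp_all add: Alg_cat_def)

lemma alg_arrD:
  assumes "(A, f, B) \<in> alg_arrs \<U> V U \<S> \<Sigma>"
  shows "A \<in> algs" "B \<in> algs" "f \<in> extensional \<S>" "S \<in> \<S> \<Longrightarrow> f S \<in> hom V (Carr A S) (Carr B S)"
    and "\<sigma> \<in> Ops \<Sigma> \<Longrightarrow> p \<in> FO U (Par \<Sigma> \<sigma>) \<Longrightarrow> xs \<in> args A (Ins \<Sigma> \<sigma>) \<Longrightarrow>
      act (f (Out \<Sigma> \<sigma>)) (opn A \<sigma> p xs) = opn B \<sigma> p (map2 (\<lambda>S. act (f S)) (Ins \<Sigma> \<sigma>) xs)"
  using assms by (auto simp: alg_arr_iff PiE_def)

text \<open>The conditional is what unfolding \<open>restrict\<close> leaves of the components of an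
  identity; for composites it arises in the same way below.\<close>

lemma map2_act_id:
  assumes "A \<in> algs" "set Ss \<subseteq> \<S>" "xs \<in> args A Ss"
  shows "map2 (\<lambda>S. act (if S \<in> \<S> then Idn V (Carr A S) else undefined)) Ss xs = xs"
  using assms(2,3) Carr_ob[OF assms(1)]
  by (auto intro!: nth_equalityI simp: in_listset_conv_nth act_id subset_iff)

lemma map2_act_comp:
  assumes "(A, f, B) \<in> alg_arrs \<U> V U \<S> \<Sigma>" "(B, g, C') \<in> alg_arrs \<U> V U \<S> \<Sigma>"
    and "set Ss \<subseteq> \<S>" "xs \<in> args A Ss"
  shows "map2 (\<lambda>S. act (if S \<in> \<S> then Cmp V (g S) (f S) else undefined)) Ss xs =
    map2 (\<lambda>S. act (g S)) Ss (map2 (\<lambda>S. act (f S)) Ss xs)"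
  using assms(3,4)
  by (auto intro!: nth_equalityI act_comp[OF alg_arrD(4)[OF assms(1)] alg_arrD(4)[OF assms(2)]]
      simp: in_listset_conv_nth subset_iff)

lemma alg_id_arr:
  assumes "A \<in> algs"
  shows "(A, \<lambda>S\<in>\<S>. Idn V (Carr A S), A) \<in> alg_arrs \<U> V U \<S> \<Sigma>"
  unfolding alg_arr_iff using assms
  by (auto simp: restrict_def map2_act_id sig_sorts act_id opn_in C.id_hom Carr_ob)

lemma alg_comp_arr:
  assumes f: "(A, f, B) \<in> alg_arrs \<U> V U \<S> \<Sigma>" and g: "(B, g, C') \<in> alg_arrs \<U> V U \<S> \<Sigma>"
  shows "(A, \<lambda>S\<in>\<S>. Cmp V (g S) (f S), C') \<in> alg_arrs \<U> V U \<S> \<Sigma>"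
  unfolding alg_arr_iff
proof (intro conjI ballI)
  show "A \<in> algs" "C' \<in> algs"
    using alg_arrD[OF f] alg_arrD[OF g] by auto
  show "(\<lambda>S\<in>\<S>. Cmp V (g S) (f S)) \<in> (\<Pi>\<^sub>E S\<in>\<S>. hom V (Carr A S) (Carr C' S))"
    using alg_arrD(4)[OF f] alg_arrD(4)[OF g] C.comp_hom by fastforce
  fix \<sigma> p xs assume \<sigma>: "\<sigma> \<in> Ops \<Sigma>" "p \<in> FO U (Par \<Sigma> \<sigma>)" and xs: "xs \<in> args A (Ins \<Sigma> \<sigma>)"
  have "map2 (\<lambda>S. act (f S)) (Ins \<Sigma> \<sigma>) xs \<in> args B (Ins \<Sigma> \<sigma>)"
    by (rule map2_args[OF xs alg_arrD(4)[OF f]]) (use sig_sorts[OF \<sigma>(1)] in auto)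
  then show "act ((\<lambda>S\<in>\<S>. Cmp V (g S) (f S)) (Out \<Sigma> \<sigma>)) (opn A \<sigma> p xs) =
      opn C' \<sigma> p (map2 (\<lambda>S. act ((\<lambda>S\<in>\<S>. Cmp V (g S) (f S)) S)) (Ins \<Sigma> \<sigma>) xs)"
    using alg_arrD(5)[OF f \<sigma> xs] alg_arrD(5)[OF g \<sigma>] map2_act_comp[OF f g sig_sorts(1)[OF \<sigma>(1)] xs]
      act_comp[OF alg_arrD(4)[OF f] alg_arrD(4)[OF g] opn_in[OF alg_arrD(1)[OF f] \<sigma> xs]]
      sig_sorts(2)[OF \<sigma>(1)]
    by (simp add: restrict_def)
qed

text \<open>An algebraic operation is a \<open>nat_trans\<close>, and that locale includes the laws
  of its source category and of both functors. They have to be established before any operation can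
  be exhibited.\<close>

lemma category_Alg: "category (Alg_cat \<U> V U \<S> \<Sigma>)"
proof
  show "Dom (Alg_cat \<U> V U \<S> \<Sigma>) m \<in> Ob (Alg_cat \<U> V U \<S> \<Sigma>)"
    "Cod (Alg_cat \<U> V U \<S> \<Sigma>) m \<in> Ob (Alg_cat \<U> V U \<S> \<Sigma>)" if "m \<in> Arr (Alg_cat \<U> V U \<S> \<Sigma>)" for m
    using that by (auto simp: Alg_cat_def alg_arrs_def)
  show "Idn (Alg_cat \<U> V U \<S> \<Sigma>) A \<in> hom (Alg_cat \<U> V U \<S> \<Sigma>) A A" if "A \<in> Ob (Alg_cat \<U> V U \<S> \<Sigma>)" for A
    using that alg_id_arr by (simp add: hom_Alg)
  show "Cmp (Alg_cat \<U> V U \<S> \<Sigma>) n m \<in> hom (Alg_cat \<U> V U \<S> \<Sigma>) A C'"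
    if "m \<in> hom (Alg_cat \<U> V U \<S> \<Sigma>) A B" "n \<in> hom (Alg_cat \<U> V U \<S> \<Sigma>) B C'" for m n A B C'
    using that alg_comp_arr by (auto simp: hom_Alg)
  show "Cmp (Alg_cat \<U> V U \<S> \<Sigma>) (Cmp (Alg_cat \<U> V U \<S> \<Sigma>) k n) m =
      Cmp (Alg_cat \<U> V U \<S> \<Sigma>) k (Cmp (Alg_cat \<U> V U \<S> \<Sigma>) n m)"
    if "m \<in> hom (Alg_cat \<U> V U \<S> \<Sigma>) A B" "n \<in> hom (Alg_cat \<U> V U \<S> \<Sigma>) B C'"
      "k \<in> hom (Alg_cat \<U> V U \<S> \<Sigma>) C' D'" for m n k A B C' D'
    using that
    by (auto simp: hom_Alg intro!: restrict_ext C.comp_assoc[OF alg_arrD(4) alg_arrD(4) alg_arrD(4)])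
  show "Cmp (Alg_cat \<U> V U \<S> \<Sigma>) (Idn (Alg_cat \<U> V U \<S> \<Sigma>) B) m = m"
    "Cmp (Alg_cat \<U> V U \<S> \<Sigma>) m (Idn (Alg_cat \<U> V U \<S> \<Sigma>) A) = m"
    if "m \<in> hom (Alg_cat \<U> V U \<S> \<Sigma>) A B" for m A B
    using that C.comp_id_left[OF alg_arrD(4)] C.comp_id_right[OF alg_arrD(4)] alg_arrD(3)
    by (auto simp: hom_Alg intro!: extensionalityI[of _ \<S>])
qed

lemma functor_carrier_at: "S \<in> \<S> \<Longrightarrow> cat_functor (Alg_cat \<U> V U \<S> \<Sigma>) V (carrier_at S)"
  by (intro cat_functor.intro category_Alg cat_functor_axioms.intro C.category_axioms)
    (auto simp: hom_Alg Carr_ob dest: alg_arrD(4))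

text \<open>All laws are checked on elements, where the functor fixes the parameter and applies the
  homomorphism to each argument.\<close>

lemma functor_param_power:
  assumes "set Ss \<subseteq> \<S>" "P \<in> Ob V"
  shows "cat_functor (Alg_cat \<U> V U \<S> \<Sigma>) V (param_power \<U> V U P Ss)"
proof (intro cat_functor.intro category_Alg cat_functor_axioms.intro C.category_axioms)
  let ?F = "param_power \<U> V U P Ss" and ?C = "Alg_cat \<U> V U \<S> \<Sigma>"
  show "FO ?F A \<in> Ob V" if "A \<in> Ob ?C" for A
    using that assms by (simp add: args_ob_ob)
  have hom: "FA ?F (A, f, B) \<in> hom V (args_ob P A Ss) (args_ob P B Ss)"
    and act_F: "p \<in> FO U P \<Longrightarrow> xs \<in> args A Ss \<Longrightarrow>
      act (FA ?F (A, f, B)) (enc \<U> (p, tup \<U> xs)) = enc \<U> (p, tup \<U> (map2 (\<lambda>S. act (f S)) Ss xs))"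
    if "(A, f, B) \<in> alg_arrs \<U> V U \<S> \<Sigma>" for A f B p xs
    using args_map_hom[OF alg_arrD(1)[OF that] assms alg_arrD(4)[OF that]] assms
      act_args_map[OF alg_arrD(1)[OF that] assms alg_arrD(4)[OF that]] by auto
  then show "FA ?F m \<in> hom V (FO ?F A) (FO ?F B)" if "m \<in> hom ?C A B" for m A B
    using that by (auto simp: hom_Alg)
  show "FA ?F (Idn ?C A) = Idn V (FO ?F A)" if "A \<in> Ob ?C" for A
  proof -
    have A: "A \<in> algs"
      using that by simp
    show ?thesis
      unfolding Alg_cat_simps param_power_simps(1)
    proof (rule args_ob_eqI[OF A assms hom[OF alg_id_arr[OF A]] C.id_hom[OF args_ob_ob[OF A assms]]])
      fix p xs assume pxs: "p \<in> FO U P" "xs \<in> args A Ss"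
      then have "enc \<U> (p, tup \<U> xs) \<in> FO U (args_ob P A Ss)"
        by (auto simp: FO_args_ob A assms)
      then show "act (FA ?F (A, \<lambda>S\<in>\<S>. Idn V (Carr A S), A)) (enc \<U> (p, tup \<U> xs)) =
          act (Idn V (args_ob P A Ss)) (enc \<U> (p, tup \<U> xs))"
        using act_F[OF alg_id_arr[OF A] pxs] map2_act_id[OF A assms(1) pxs(2)]
          act_id[OF args_ob_ob[OF A assms]] by (simp add: restrict_def)
    qed
  qed
  show "FA ?F (Cmp ?C n m) = Cmp V (FA ?F n) (FA ?F m)"
    if m: "m \<in> hom ?C A B" and n: "n \<in> hom ?C B C'" for m n A B C'
  proof -
    obtain f g where f: "m = (A, f, B)" "(A, f, B) \<in> alg_arrs \<U> V U \<S> \<Sigma>"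
      and g: "n = (B, g, C')" "(B, g, C') \<in> alg_arrs \<U> V U \<S> \<Sigma>"
      using m n by (auto simp: hom_Alg)
    note A = alg_arrD(1)[OF f(2)] and gf = alg_comp_arr[OF f(2) g(2)]
    show ?thesis
      unfolding f(1) g(1) Alg_cat_simps
    proof (rule args_ob_eqI[OF A assms hom[OF gf] C.comp_hom[OF hom[OF f(2)] hom[OF g(2)]]])
      fix p xs assume p: "p \<in> FO U P" and xs: "xs \<in> args A Ss"
      then have z: "enc \<U> (p, tup \<U> xs) \<in> FO U (args_ob P A Ss)"
        by (auto simp: FO_args_ob A assms)
      have "map2 (\<lambda>S. act (f S)) Ss xs \<in> args B Ss"
        by (rule map2_args[OF xs alg_arrD(4)[OF f(2)]]) (use assms in auto)
      then show "act (FA ?F (A, \<lambda>S\<in>\<S>. Cmp V (g S) (f S), C')) (enc \<U> (p, tup \<U> xs)) =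
          act (Cmp V (FA ?F (B, g, C')) (FA ?F (A, f, B))) (enc \<U> (p, tup \<U> xs))"
        unfolding act_F[OF gf p xs] act_comp[OF hom[OF f(2)] hom[OF g(2)] z] act_F[OF f(2) p xs]
        using act_F[OF g(2) p] map2_act_comp[OF f(2) g(2) assms(1) xs] by (simp add: restrict_def)
    qed
  qed
qed

section \<open>Underlying classical algebras and evaluation of terms\<close>

lemma und_simps [simp]:
  "S \<in> \<S> \<Longrightarrow> cCarr (und A) S = FO U (Carr A S)"
  "\<sigma> \<in> Ops \<Sigma> \<Longrightarrow> p \<in> FO U (Par \<Sigma> \<sigma>) \<Longrightarrow> xs \<in> args A (Ins \<Sigma> \<sigma>) \<Longrightarrow>
     cIntp (und A) (\<sigma>, p) xs = opn A \<sigma> p xs"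
  by (simp_all add: und_alg_def)

lemma und_in_classical_algebras:
  assumes "A \<in> algs"
  shows "und A \<in> classical_algebras \<U> \<S> (und_sig U \<Sigma>)"
proof -
  have "cIntp (und A) \<in> (\<Pi>\<^sub>E \<sigma>\<in>Ops (und_sig U \<Sigma>).
      listset (map (cCarr (und A)) (Ins (und_sig U \<Sigma>) \<sigma>)) \<rightarrow>\<^sub>E cCarr (und A) (Out (und_sig U \<Sigma>) \<sigma>))"
  proof (rule PiE_I)
    fix \<sigma>p assume "\<sigma>p \<in> Ops (und_sig U \<Sigma>)"
    then obtain \<sigma> p where \<sigma>p: "\<sigma>p = (\<sigma>, p)" "\<sigma> \<in> Ops \<Sigma>" "p \<in> FO U (Par \<Sigma> \<sigma>)"
      by auto
    have "map (cCarr (und A)) (Ins \<Sigma> \<sigma>) = map (\<lambda>S. FO U (Carr A S)) (Ins \<Sigma> \<sigma>)"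
      and "cCarr (und A) (Out \<Sigma> \<sigma>) = FO U (Carr A (Out \<Sigma> \<sigma>))"
      and "cIntp (und A) (\<sigma>, p) \<in> args A (Ins \<Sigma> \<sigma>) \<rightarrow>\<^sub>E FO U (Carr A (Out \<Sigma> \<sigma>))"
      using sig_sorts[OF \<sigma>p(2)] \<sigma>p(2,3) opn_in[OF assms \<sigma>p(2,3)] by (auto simp: und_alg_def)
    then show "cIntp (und A) \<sigma>p \<in> listset (map (cCarr (und A)) (Ins (und_sig U \<Sigma>) \<sigma>p)) \<rightarrow>\<^sub>E
        cCarr (und A) (Out (und_sig U \<Sigma>) \<sigma>p)"
      by (simp only: \<sigma>p(1) und_sig_simps)
  qed (auto simp: und_alg_def)
  moreover have "cCarr (und A) \<in> \<S> \<rightarrow>\<^sub>E small_sets \<U>"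
    using FO_small[OF Carr_ob[OF assms]] by (auto simp: und_alg_def)
  ultimately show ?thesis
    by (simp add: classical_algebras_def)
qed

lemma term_in_context_sort:
  "term_in_context (und_sig U \<Sigma>) vs t S \<Longrightarrow> fst ` set vs \<subseteq> \<S> \<Longrightarrow> S \<in> \<S>"
  by (cases rule: term_in_context.cases) (auto simp: sig_sorts)

lemma eval_args:
  assumes "length ts = length Ss"
    and "\<And>j. j < length ts \<Longrightarrow> eval_term (und A) \<rho> (ts ! j) \<in> FO U (Carr A (Ss ! j))"
  shows "map (eval_term (und A) \<rho>) ts \<in> args A Ss"
  using assms by (auto simp: in_listset_conv_nth)

lemma eval_term_in:
  assumes "term_in_context (und_sig U \<Sigma>) vs t S" "A \<in> algs"
    and "\<And>v. v \<in> set vs \<Longrightarrow> \<rho> v \<in> FO U (Carr A (fst v))"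
  shows "eval_term (und A) \<rho> t \<in> FO U (Carr A S)"
  using assms(1)
proof induction
  case (2 \<sigma>p ts)
  then show ?case
    by (cases \<sigma>p) (auto simp: opn_in assms(2) eval_args)
qed (simp add: assms)

text \<open>Induction on the term, the application case being the homomorphism law. It provides
  naturality for the operation that a term defines.\<close>

lemma eval_term_natural:
  assumes f: "(A, f, B) \<in> alg_arrs \<U> V U \<S> \<Sigma>"
    and \<rho>: "\<And>v. v \<in> set vs \<Longrightarrow> \<rho> v \<in> FO U (Carr A (fst v))"
    and \<rho>': "\<And>v. v \<in> set vs \<Longrightarrow> \<rho>' v = act (f (fst v)) (\<rho> v)"
    and sorts: "fst ` set vs \<subseteq> \<S>"
    and t: "term_in_context (und_sig U \<Sigma>) vs t S"
  shows "act (f S) (eval_term (und A) \<rho> t) = eval_term (und B) \<rho>' t"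
  using t
proof induction
  case (2 \<sigma>p ts)
  obtain \<sigma> p where \<sigma>p: "\<sigma>p = (\<sigma>, p)" "\<sigma> \<in> Ops \<Sigma>" "p \<in> FO U (Par \<Sigma> \<sigma>)"
    using 2(1) by auto
  have xs: "map (eval_term (und A) \<rho>) ts \<in> args A (Ins \<Sigma> \<sigma>)"
    using 2 \<sigma>p eval_term_in[of vs, OF _ alg_arrD(1)[OF f] \<rho>] by (auto intro!: eval_args)
  moreover have "map2 (\<lambda>S. act (f S)) (Ins \<Sigma> \<sigma>) (map (eval_term (und A) \<rho>) ts) = map (eval_term (und B) \<rho>') ts"
    using 2 \<sigma>p by (auto intro!: nth_equalityI)
  \<comment> \<open>The operations of \<open>und B\<close> are cut off outside their argument lists,
    so this membership is needed to unfold them.\<close>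
  moreover have "map2 (\<lambda>S. act (f S)) (Ins \<Sigma> \<sigma>) (map (eval_term (und A) \<rho>) ts) \<in> args B (Ins \<Sigma> \<sigma>)"
    by (rule map2_args[OF xs alg_arrD(4)[OF f]]) (use sig_sorts[OF \<sigma>p(2)] in auto)
  ultimately show ?case
    using alg_arrD(5)[OF f \<sigma>p(2,3) xs] \<sigma>p by simp
qed (simp add: \<rho>')

abbreviation val :: "'s var list \<Rightarrow> 'u list \<Rightarrow> 's var \<Rightarrow> 'u" where
  "val vs xs \<equiv> \<lambda>v. the (map_of (zip vs xs) v)"

text \<open>\<open>map_of\<close> returns the first match; distinctness of the variables makes it
  the one at position \<open>i\<close>.\<close>

lemma val_nth: "distinct vs \<Longrightarrow> length xs = length vs \<Longrightarrow> i < length vs \<Longrightarrow> val vs xs (vs ! i) = xs ! i"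
  by (simp add: map_of_zip_nth)

lemma val_in:
  assumes "distinct vs" "xs \<in> args A (map fst vs)" "v \<in> set vs"
  shows "val vs xs v \<in> FO U (Carr A (fst v))"
  using assms by (auto simp: in_listset_conv_nth in_set_conv_nth val_nth)

lemma interp_term_eq_iff:
  assumes "fst ` set vs \<subseteq> \<S>"
  shows "interp_term (und A) vs s = interp_term (und A) vs t \<longleftrightarrow>
    (\<forall>xs\<in>args A (map fst vs). eval_term (und A) (val vs xs) s = eval_term (und A) (val vs xs) t)"
proof -
  have "map (cCarr (und A) \<circ> fst) vs = map (\<lambda>S. FO U (Carr A S)) (map fst vs)"
    using assms by auto
  then show ?thesis
    by (simp only: interp_term_def restrict_eq_iff)
qed

end

section \<open>Classical equations as enriched ones\<close>

context enriched_setting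
begin

text \<open>Functions out of a one-point set are constant, so this says that every function from
  \<open>D\<close> to an object is admissible.\<close>

definition discrete_point :: "'v \<Rightarrow> bool" where
  "discrete_point D \<longleftrightarrow> D \<in> Ob V \<and> FO U D = {pt \<U>} \<and>
     (\<forall>Y\<in>Ob V. \<forall>y\<in>FO U Y. adm D Y (\<lambda>_. y))"

text \<open>The source consists of all functions from a point to all objects, a large source in
  general; its lift makes each of them admissible.\<close>

lemma discrete_point_exists: "\<exists>D. discrete_point D"
proof -
  let ?K = "{(Y, k). Y \<in> Ob V \<and> k \<in> {pt \<U>} \<rightarrow> FO U Y}"
  show ?thesis
  proof (rule initial_lift_adm[OF small_singleton, of ?K "pt \<U>"])
    fix D assume "D \<in> Ob V" "FO U D = {pt \<U>}" "\<And>Y k. (Y, k) \<in> ?K \<Longrightarrow> adm D Y k"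
    then show ?thesis
      unfolding discrete_point_def by (intro exI[of _ D]) auto
  qed auto
qed

text \<open>The composite D (x) X -> (D (x) D) (x) X -> D (x) (D (x) X) -> P (x) Y: the first copy
  of \<open>D\<close> is sent to \<open>p\<close>, the second is consumed by
  \<open>f\<close>.\<close>

lemma adm_with_param:
  assumes D: "discrete_point D" and X: "X \<in> Ob V" and P: "P \<in> Ob V" "p \<in> FO U P"
    and f: "adm (D \<otimes>\<^bsub>V\<^esub> X) Y f"
  shows "adm (D \<otimes>\<^bsub>V\<^esub> X) (P \<otimes>\<^bsub>V\<^esub> Y) (\<lambda>z. enc \<U> (p, f z))"
proof -
  have D': "D \<in> Ob V" "FO U D = {pt \<U>}"
    using D by (auto simp: discrete_point_def)
  have diag: "adm D (D \<otimes>\<^bsub>V\<^esub> D) (\<lambda>_. enc \<U> (pt \<U>, pt \<U>))" and p: "adm D P (\<lambda>_. p)"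
    using D P by (simp_all add: discrete_point_def M.ten_ob FO_ten)
  show ?thesis
    by (rule adm_cong[OF adm_comp[OF adm_comp[OF adm_ten[OF diag adm_id[OF X]]
            adm_assoc[OF D'(1) D'(1) X]] adm_ten[OF p f]]])
      (auto simp: FO_ten D' X elim!: set_prodE)
qed

text \<open>The function is built along the term. Since \<open>pt\<close> is the only point of
  \<open>D\<close>, the prescribed values cover the whole carrier of
  \<open>args_ob D A (map fst vs)\<close>.\<close>

lemma adm_eval_term:
  assumes D: "discrete_point D" and A: "A \<in> algs" and vs: "is_context \<S> vs"
    and t: "term_in_context (und_sig U \<Sigma>) vs t S"
  shows "\<exists>f. adm (args_ob D A (map fst vs)) (Carr A S) f \<and>
    (\<forall>xs\<in>args A (map fst vs). f (enc \<U> (pt \<U>, tup \<U> xs)) = eval_term (und A) (val vs xs) t)"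
  using t
proof induction
  have D': "D \<in> Ob V" "FO U D = {pt \<U>}"
    using D by (auto simp: discrete_point_def)
  have vs': "distinct vs" "set (map fst vs) \<subseteq> \<S>"
    using vs by (auto simp: is_context_def)
  note Cs = Carrs_ob[OF A vs'(2)]
  let ?X = "prodO \<U> V U (map (Carr A) (map fst vs))"
  {
    case (1 v)
    then obtain i where i: "i < length vs" "v = vs ! i"
      by (auto simp: in_set_conv_nth)
    \<comment> \<open>A variable ignores the parameter: \<open>D\<close> is sent to the unit, the
      unit is removed, and a product projection follows.\<close>
    have pt: "adm D \<one>\<^bsub>V\<^esub> (\<lambda>_. pt \<U>)"
      using D M.unit_ob FO_unit by (auto simp: discrete_point_def)
    have "adm ?X (Carr A (fst v)) (tup_nth \<U> i)"
      using adm_prodP[OF Cs, of i] i by simp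
    note adm = adm_comp[OF adm_comp[OF adm_ten[OF pt adm_id[OF prodO_ob[OF Cs]]]
        adm_lunit[OF prodO_ob[OF Cs]]] this]
    show ?case
      by (intro exI conjI ballI, rule adm) (use i val_nth[OF vs'(1)] in \<open>auto simp: in_listset_conv_nth\<close>)
  next
    case (2 \<sigma>p ts)
    obtain \<sigma> p where \<sigma>p: "\<sigma>p = (\<sigma>, p)" "\<sigma> \<in> Ops \<Sigma>" "p \<in> FO U (Par \<Sigma> \<sigma>)"
      using 2(1) by auto
    have len: "length ts = length (Ins \<Sigma> \<sigma>)"
      using 2(2) \<sigma>p by simp
    obtain h where h: "\<And>j. j < length ts \<Longrightarrow> adm (args_ob D A (map fst vs)) (Carr A (Ins \<Sigma> \<sigma> ! j)) (h j)"
      "\<And>j xs. j < length ts \<Longrightarrow> xs \<in> args A (map fst vs) \<Longrightarrow>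
        h j (enc \<U> (pt \<U>, tup \<U> xs)) = eval_term (und A) (val vs xs) (ts ! j)"
      using 2(4) \<sigma>p(1) by (simp only: und_sig_simps) metis
    let ?hs = "map h [0..<length ts]"
    \<comment> \<open>All arguments depend on the same pair of parameter and valuation, which the
      cartesian product allows them to share. One more copy of \<open>D\<close> then produces the
      parameter \<open>p\<close> of the outermost symbol.\<close>
    have "adm (args_ob D A (map fst vs)) (prodO \<U> V U (map (Carr A) (Ins \<Sigma> \<sigma>))) (\<lambda>w. tup \<U> (map (\<lambda>h. h w) ?hs))"
      by (rule adm_prodI) (use h(1) len Carrs_ob[OF A sig_sorts(1)[OF \<sigma>p(2)]] args_ob_ob[OF A vs'(2) D'(1)] in auto)
    note adm = adm_comp[OF adm_with_param[OF D prodO_ob[OF Cs] Par_ob[OF \<sigma>p(2)] \<sigma>p(3) this]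
        adm_hom[OF Intp_hom[OF A \<sigma>p(2)]]]
    show ?case
    proof (intro exI conjI ballI)
      show "adm (args_ob D A (map fst vs)) (Carr A (Out (und_sig U \<Sigma>) \<sigma>p))
          (\<lambda>x. opn A \<sigma> p (map (\<lambda>h. h x) ?hs))"
        using adm by (simp only: \<sigma>p(1) und_sig_simps)
      fix xs assume xs: "xs \<in> args A (map fst vs)"
      have "map (\<lambda>h. h (enc \<U> (pt \<U>, tup \<U> xs))) ?hs = map (eval_term (und A) (val vs xs)) ts"
        using h(2)[OF _ xs] by (auto intro: nth_equalityI)
      moreover have "map (eval_term (und A) (val vs xs)) ts \<in> args A (Ins \<Sigma> \<sigma>)"
        using 2(3) eval_term_in[OF _ A val_in[OF vs'(1) xs]] len \<sigma>p(1) by (intro eval_args) auto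
      ultimately show "opn A \<sigma> p (map (\<lambda>h. h (enc \<U> (pt \<U>, tup \<U> xs))) ?hs) =
          eval_term (und A) (val vs xs) (App \<sigma>p ts)"
        using \<sigma>p by simp
    qed
  }
qed

text \<open>The components come from \<open>adm_eval_term\<close>, their naturality from
  \<open>eval_term_natural\<close>.\<close>

lemma term_operation:
  assumes D: "discrete_point D" and vs: "is_context \<S> vs"
    and t: "term_in_context (und_sig U \<Sigma>) vs t S"
  shows "\<exists>\<omega>. algebraic_operation \<U> V U \<S> \<Sigma> (map fst vs) S D \<omega> \<and>
    (\<forall>A\<in>algs. \<forall>xs\<in>args A (map fst vs).
       act (\<omega> A) (enc \<U> (pt \<U>, tup \<U> xs)) = eval_term (und A) (val vs xs) t)"
proof -
  let ?Ss = "map fst vs"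
  have D': "D \<in> Ob V" "FO U D = {pt \<U>}"
    using D by (auto simp: discrete_point_def)
  have vs': "distinct vs" "fst ` set vs \<subseteq> \<S>" "set ?Ss \<subseteq> \<S>"
    using vs by (auto simp: is_context_def)
  note S = term_in_context_sort[OF t vs'(2)]
  have "\<exists>m. m \<in> hom V (args_ob D A ?Ss) (Carr A S) \<and>
      (\<forall>xs\<in>args A ?Ss. act m (enc \<U> (pt \<U>, tup \<U> xs)) = eval_term (und A) (val vs xs) t)"
    if A: "A \<in> algs" for A
    using adm_eval_term[OF D A vs t] FO_args_ob[OF A vs'(3) D'(1)] D'(2) unfolding adm_def by fastforce
  then obtain w where w: "\<And>A. A \<in> algs \<Longrightarrow> w A \<in> hom V (args_ob D A ?Ss) (Carr A S)"
    "\<And>A xs. A \<in> algs \<Longrightarrow> xs \<in> args A ?Ss \<Longrightarrow>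
      act (w A) (enc \<U> (pt \<U>, tup \<U> xs)) = eval_term (und A) (val vs xs) t"
    by metis
  \<comment> \<open>Natural transformations are extensional on the objects of their source.\<close>
  let ?\<omega> = "restrict w algs"
  have "Cmp V (FA (carrier_at S) m) (?\<omega> A) = Cmp V (?\<omega> B) (FA (param_power \<U> V U D ?Ss) m)"
    if m: "m \<in> hom (Alg_cat \<U> V U \<S> \<Sigma>) A B" for m A B
  proof -
    obtain f where f: "m = (A, f, B)" "(A, f, B) \<in> alg_arrs \<U> V U \<S> \<Sigma>"
      using m by (auto simp: hom_Alg)
    note A = alg_arrD(1)[OF f(2)] and B = alg_arrD(2)[OF f(2)]
    have fS: "f S' \<in> hom V (Carr A S') (Carr B S')" if "S' \<in> set ?Ss" for S'
      using alg_arrD(4)[OF f(2)] that vs'(3) by blast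
    note pm = args_map_hom[OF A vs'(3) D'(1) fS]
    have "Cmp V (f S) (w A) = Cmp V (w B) (Idn V D \<boxtimes>\<^bsub>V\<^esub> prodA \<U> V U (map f ?Ss))"
    proof (rule args_ob_eqI[OF A vs'(3) D'(1) C.comp_hom[OF w(1)[OF A] alg_arrD(4)[OF f(2) S]]
          C.comp_hom[OF pm w(1)[OF B]]])
      fix p xs assume p: "p \<in> FO U D" and xs: "xs \<in> args A ?Ss"
      have z: "enc \<U> (p, tup \<U> xs) \<in> FO U (args_ob D A ?Ss)"
        using p xs FO_args_ob[OF A vs'(3) D'(1)] by force
      have ys: "map2 (\<lambda>S. act (f S)) ?Ss xs \<in> args B ?Ss"
        by (rule map2_args[OF xs fS])
      have "act (f S) (eval_term (und A) (val vs xs) t) =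
          eval_term (und B) (val vs (map2 (\<lambda>S. act (f S)) ?Ss xs)) t"
      proof (rule eval_term_natural[OF f(2) val_in[OF vs'(1) xs] _ vs'(2) t])
        show "val vs (map2 (\<lambda>S. act (f S)) ?Ss xs) v = act (f (fst v)) (val vs xs v)" if "v \<in> set vs" for v
          using that xs vs'(1) val_nth[OF vs'(1)] by (auto simp: in_set_conv_nth in_listset_conv_nth)
      qed
      then show "act (Cmp V (f S) (w A)) (enc \<U> (p, tup \<U> xs)) =
          act (Cmp V (w B) (Idn V D \<boxtimes>\<^bsub>V\<^esub> prodA \<U> V U (map f ?Ss))) (enc \<U> (p, tup \<U> xs))"
        using act_comp[OF w(1)[OF A] alg_arrD(4)[OF f(2) S] z] act_comp[OF pm w(1)[OF B] z]
          act_args_map[OF A vs'(3) D'(1) fS p xs] w(2)[OF A xs] w(2)[OF B ys] p D'(2)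
        by simp
    qed
    then show ?thesis
      using A B f(1) by simp
  qed
  then have "nat_trans (Alg_cat \<U> V U \<S> \<Sigma>) V (param_power \<U> V U D ?Ss) (carrier_at S) ?\<omega>"
    using w(1)
    by (intro nat_trans.intro functor_param_power functor_carrier_at vs' D' S nat_trans_axioms.intro) auto
  then have "algebraic_operation \<U> V U \<S> \<Sigma> ?Ss S D ?\<omega>"
    using vs' S D' by (simp add: algebraic_operation_def)
  then show ?thesis
    using w(2) by (intro exI[of _ ?\<omega>]) auto
qed

lemma classical_signature_und_sig: "classical_signature \<U> \<S> (und_sig U \<Sigma>)"
  using signature sig_sorts FO_small[OF Par_ob]
  by (auto simp: classical_signature_def enriched_signature_def is_small_iff intro!: is_small_Sigma)

text \<open>Each classical equation becomes one enriched equation, always with the same parameter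
  \<open>D\<close>.\<close>

lemma classical_to_enriched:
  assumes E: "classical_theory \<U> \<S> (und_sig U \<Sigma>) E"
  shows "\<exists>E'. enriched_theory \<U> V U \<S> \<Sigma> E' \<and>
    (\<forall>A\<in>algs. A \<in> theory_algebras \<U> V U \<S> \<Sigma> E' \<longleftrightarrow>
       und A \<in> classical_theory_algebras \<U> \<S> (und_sig U \<Sigma>) E)"
proof -
  obtain D where D: "discrete_point D"
    using discrete_point_exists ..
  then have D': "D \<in> Ob V" "FO U D = {pt \<U>}"
    by (auto simp: discrete_point_def)
  obtain op where op: "\<And>vs t S. is_context \<S> vs \<Longrightarrow> term_in_context (und_sig U \<Sigma>) vs t S \<Longrightarrow>
      algebraic_operation \<U> V U \<S> \<Sigma> (map fst vs) S D (op vs t S)"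
    "\<And>vs t S A xs. is_context \<S> vs \<Longrightarrow> term_in_context (und_sig U \<Sigma>) vs t S \<Longrightarrow> A \<in> algs \<Longrightarrow>
      xs \<in> args A (map fst vs) \<Longrightarrow>
      act (op vs t S A) (enc \<U> (pt \<U>, tup \<U> xs)) = eval_term (und A) (val vs xs) t"
    using term_operation[OF D] by metis
  have e: "is_context \<S> (ctxt e)" "term_in_context (und_sig U \<Sigma>) (ctxt e) (lhs e) (srt e)"
    "term_in_context (und_sig U \<Sigma>) (ctxt e) (rhs e) (srt e)" if "e \<in> E" for e
    using E that by (auto simp: classical_theory_def)
  let ?q = "\<lambda>e. \<lparr>eqIns = map fst (ctxt e), eqOut = srt e, eqPar = D,
    eqL = op (ctxt e) (lhs e) (srt e), eqR = op (ctxt e) (rhs e) (srt e)\<rparr>"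
  have "enriched_theory \<U> V U \<S> \<Sigma> (?q ` E)"
    using signature E e op(1) by (auto simp: enriched_theory_def classical_theory_def intro!: is_small_image)
  moreover have "A \<in> theory_algebras \<U> V U \<S> \<Sigma> (?q ` E) \<longleftrightarrow>
      und A \<in> classical_theory_algebras \<U> \<S> (und_sig U \<Sigma>) E" if A: "A \<in> algs" for A
  proof -
    \<comment> \<open>An element of the domain is the single point of \<open>D\<close> with an
      argument list, so both sides compare the same values on the same lists.\<close>
    have "op (ctxt e) (lhs e) (srt e) A = op (ctxt e) (rhs e) (srt e) A \<longleftrightarrow>
        interp_term (und A) (ctxt e) (lhs e) = interp_term (und A) (ctxt e) (rhs e)" if "e \<in> E" for e
    proof -
      have vs: "fst ` set (ctxt e) \<subseteq> \<S>" "set (map fst (ctxt e)) \<subseteq> \<S>"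
        using e(1)[OF that] by (auto simp: is_context_def)
      have hom: "op (ctxt e) t (srt e) A \<in> hom V (args_ob D A (map fst (ctxt e))) (Carr A (srt e))"
        if "term_in_context (und_sig U \<Sigma>) (ctxt e) t (srt e)" for t
        using op(1)[OF e(1)[OF \<open>e \<in> E\<close>] that] A
        by (auto simp: algebraic_operation_def dest: nat_trans.component)
      show ?thesis
        unfolding interp_term_eq_iff[OF vs(1)]
        using args_ob_eqI[OF A vs(2) D'(1) hom[OF e(2)[OF that]] hom[OF e(3)[OF that]]] D'(2)
          op(2)[OF e(1,2)[OF that] A] op(2)[OF e(1,3)[OF that] A]
        by (metis singletonD)
    qed
    then show ?thesis
      using A und_in_classical_algebras[OF A] by (auto simp: theory_algebras_def classical_theory_algebras_def)
  qed
  ultimately show ?thesis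
    by blast
qed

end

section \<open>Enriched equations as classical ones\<close>

context enriched_setting
begin

text \<open>Kept to what a naturality argument consumes: every element is the code
  \<open>h t\<close> of a term, and every valuation extends to a homomorphism whose values on codes
  are the evaluations.\<close>

lemma free_algebra:
  assumes vs: "is_context \<S> vs"
  obtains F h where "F \<in> algs"
    "\<And>S. S \<in> \<S> \<Longrightarrow> FO U (Carr F S) = h ` {t. term_in_context (und_sig U \<Sigma>) vs t S}"
    "\<And>B \<rho>. B \<in> algs \<Longrightarrow> (\<And>v. v \<in> set vs \<Longrightarrow> \<rho> v \<in> FO U (Carr B (fst v))) \<Longrightarrow>
      \<exists>f. (F, f, B) \<in> alg_arrs \<U> V U \<S> \<Sigma> \<and>
        (\<forall>S t. term_in_context (und_sig U \<Sigma>) vs t S \<longrightarrow> act (f S) (h t) = eval_term (und B) \<rho> t)"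
proof -
  let ?tm = "term_in_context (und_sig U \<Sigma>) vs"
  define T where "T = {t. \<exists>S. ?tm t S}"
  have vs': "fst ` set vs \<subseteq> \<S>"
    using vs by (auto simp: is_context_def)
  have "is_small \<U> T"
    unfolding T_def using classical_signature_und_sig by (intro is_small_terms) (simp add: classical_signature_def)
  \<comment> \<open>Carriers consist of elements of \<open>'u\<close>, so terms enter through an
    injective code \<open>h\<close>, undone by \<open>d\<close>.\<close>
  then obtain h where h: "inj_on h T" "h ` T \<in> small_sets \<U>"
    by (auto simp: is_small_def)
  define d where "d = inv_into T h"
  have d [simp]: "d (h t) = t" if "?tm t S" for t S
    unfolding d_def using that by (intro inv_into_f_f[OF h(1)]) (auto simp: T_def)
  define Z where "Z S = h ` {t. ?tm t S}" for S
  have Z: "Z S \<in> small_sets \<U>" for S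
    by (rule small_subset[OF h(2)]) (auto simp: Z_def T_def)
  \<comment> \<open>The pairs (B, \<rho>) of an algebra and a valuation of the context index the
    source along which the term algebra is lifted.\<close>
  define ok where "ok B \<rho> \<longleftrightarrow> B \<in> algs \<and> (\<forall>v\<in>set vs. \<rho> v \<in> FO U (Carr B (fst v)))" for B \<rho>
  define ev where "ev B \<rho> z = eval_term (und B) \<rho> (d z)" for B \<rho> z
  have ev_in: "ev B \<rho> \<in> Z S \<rightarrow> FO U (Carr B S)" if "ok B \<rho>" for B \<rho> S
    using that by (auto simp: ev_def Z_def ok_def intro!: eval_term_in)
  \<comment> \<open>Bundles the properties of an initial lift at sort \<open>S\<close>, so that one
    object per sort can be chosen at once.\<close>
  define lift where "lift S X \<longleftrightarrow> X \<in> Ob V \<and> FO U X = Z S \<and>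
      (\<forall>B \<rho>. ok B \<rho> \<longrightarrow> adm X (Carr B S) (ev B \<rho>)) \<and>
      (\<forall>W g. W \<in> Ob V \<longrightarrow> g \<in> FO U W \<rightarrow> Z S \<longrightarrow>
        (\<forall>B \<rho>. ok B \<rho> \<longrightarrow> adm W (Carr B S) (\<lambda>x. ev B \<rho> (g x))) \<longrightarrow> adm W X g)" for S X
  have "\<exists>X. lift S X" if S: "S \<in> \<S>" for S
  proof -
    let ?K = "{(Carr B S, ev B \<rho>) |B \<rho>. ok B \<rho>}"
    have K: "Y \<in> Ob V \<and> k \<in> Z S \<rightarrow> FO U Y" if "(Y, k) \<in> ?K" for Y k
      using that S ev_in Carr_ob by (auto simp: ok_def)
    show ?thesis
    proof (rule initial_lift_adm[OF Z K])
      fix X assume X: "X \<in> Ob V" "FO U X = Z S" "\<And>Y k. (Y, k) \<in> ?K \<Longrightarrow> adm X Y k"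
        "\<And>W g. W \<in> Ob V \<Longrightarrow> g \<in> FO U W \<rightarrow> Z S \<Longrightarrow> (\<And>Y k. (Y, k) \<in> ?K \<Longrightarrow> adm W Y (\<lambda>x. k (g x))) \<Longrightarrow> adm W X g"
      show "\<exists>X. lift S X"
        unfolding lift_def
      proof (intro exI[of _ X] conjI allI impI)
        show "adm X (Carr B S) (ev B \<rho>)" if "ok B \<rho>" for B \<rho>
          using that by (intro X(3)) auto
        show "adm W X g" if "W \<in> Ob V" "g \<in> FO U W \<rightarrow> Z S"
          and "\<forall>B \<rho>. ok B \<rho> \<longrightarrow> adm W (Carr B S) (\<lambda>x. ev B \<rho> (g x))" for W g
          by (rule X(4)[OF that(1,2)]) (use that(3) in auto)
      qed (rule X)+
    qed
  qed
  then obtain c where lift: "\<And>S. S \<in> \<S> \<Longrightarrow> lift S (c S)"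
    by metis
  have c: "\<And>S. S \<in> \<S> \<Longrightarrow> c S \<in> Ob V" "\<And>S. S \<in> \<S> \<Longrightarrow> FO U (c S) = Z S"
    and c_ev: "\<And>S B \<rho>. S \<in> \<S> \<Longrightarrow> ok B \<rho> \<Longrightarrow> adm (c S) (Carr B S) (ev B \<rho>)"
    and c_lift: "\<And>S W g. S \<in> \<S> \<Longrightarrow> W \<in> Ob V \<Longrightarrow> g \<in> FO U W \<rightarrow> Z S \<Longrightarrow>
      (\<And>B \<rho>. ok B \<rho> \<Longrightarrow> adm W (Carr B S) (\<lambda>x. ev B \<rho> (g x))) \<Longrightarrow> adm W (c S) g"
    using lift unfolding lift_def by blast+
  have tm: "?tm (App (\<sigma>, p) (map d xs)) (Out \<Sigma> \<sigma>)"
    if "\<sigma> \<in> Ops \<Sigma>" "p \<in> FO U (Par \<Sigma> \<sigma>)" "xs \<in> listset (map Z (Ins \<Sigma> \<sigma>))" for \<sigma> p xs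
  proof -
    have "?tm (App (\<sigma>, p) (map d xs)) (Out (und_sig U \<Sigma>) (\<sigma>, p))"
      by (rule term_in_context.intros(2)) (use that in \<open>auto simp: in_listset_conv_nth Z_def\<close>)
    then show ?thesis
      by simp
  qed
  \<comment> \<open>The homomorphism law for evaluation, at first only between functions. It yields
    admissibility of the operations now and the morphism property of the extension later.\<close>
  have ev_App: "ev B \<rho> (h (App (\<sigma>, p) (map d xs))) = opn B \<sigma> p (map (ev B \<rho>) xs)"
    if \<sigma>: "\<sigma> \<in> Ops \<Sigma>" "p \<in> FO U (Par \<Sigma> \<sigma>)" and xs: "xs \<in> listset (map Z (Ins \<Sigma> \<sigma>))" and ok: "ok B \<rho>"
    for \<sigma> p xs B \<rho>
  proof -
    have eq: "map (eval_term (und B) \<rho>) (map d xs) = map (ev B \<rho>) xs"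
      by (simp add: ev_def)
    have "map (ev B \<rho>) xs \<in> args B (Ins \<Sigma> \<sigma>)"
      using xs ev_in[OF ok] by (auto simp: in_listset_conv_nth)
    moreover have "ev B \<rho> (h (App (\<sigma>, p) (map d xs))) = cIntp (und B) (\<sigma>, p) (map (ev B \<rho>) xs)"
      unfolding eq[symmetric] ev_def d[OF tm[OF \<sigma> xs]] by (rule eval_term.simps)
    ultimately show ?thesis
      using \<sigma> by simp
  qed
  define is_op where "is_op \<sigma> m \<longleftrightarrow>
      m \<in> hom V (Par \<Sigma> \<sigma> \<otimes>\<^bsub>V\<^esub> prodO \<U> V U (map c (Ins \<Sigma> \<sigma>))) (c (Out \<Sigma> \<sigma>)) \<and>
      (\<forall>p\<in>FO U (Par \<Sigma> \<sigma>). \<forall>xs\<in>listset (map Z (Ins \<Sigma> \<sigma>)).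
        act m (enc \<U> (p, tup \<U> xs)) = h (App (\<sigma>, p) (map d xs)))" for \<sigma> m
  have "\<exists>m. is_op \<sigma> m" if \<sigma>: "\<sigma> \<in> Ops \<Sigma>" for \<sigma>
  proof -
    let ?Ss = "Ins \<Sigma> \<sigma>" and ?W = "Par \<Sigma> \<sigma> \<otimes>\<^bsub>V\<^esub> prodO \<U> V U (map c (Ins \<Sigma> \<sigma>))"
    let ?n = "length ?Ss"
    have cs: "set (map c ?Ss) \<subseteq> Ob V"
      using c(1) sig_sorts(1)[OF \<sigma>] by auto
    have W: "?W \<in> Ob V"
      by (intro M.ten_ob Par_ob \<sigma> prodO_ob cs)
    have "map (FO U) (map c ?Ss) = map Z ?Ss"
      using c(2) sig_sorts(1)[OF \<sigma>] by auto
    then have FO_W: "FO U ?W = set_prod \<U> (FO U (Par \<Sigma> \<sigma>)) (tuples \<U> (map Z ?Ss))"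
      by (simp only: FO_ten[OF Par_ob[OF \<sigma>] prodO_ob[OF cs]] FO_prodO[OF cs])
    \<comment> \<open>Formation of the application term, read off the coded pair of a parameter and
      a tuple of codes.\<close>
    define g where "g z = (let (p, w) = dec \<U> z in
      h (App (\<sigma>, p) (map (\<lambda>i. d (tup_nth \<U> i w)) [0..<?n])))" for z
    have g: "g (enc \<U> (p, tup \<U> xs)) = h (App (\<sigma>, p) (map d xs))" if "xs \<in> listset (map Z ?Ss)" for p xs
    proof -
      have "map (\<lambda>i. d (tup_nth \<U> i (tup \<U> xs))) [0..<?n] = map d xs"
        using that by (auto simp: in_listset_conv_nth intro: nth_equalityI)
      then show ?thesis
        by (simp add: g_def)
    qed
    \<comment> \<open>By initiality it is enough to follow \<open>g\<close> by each evaluation; by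
      \<open>ev_App\<close> the result is the operation of \<open>B\<close> after evaluating the
      arguments coordinatewise.\<close>
    have "adm ?W (c (Out \<Sigma> \<sigma>)) g"
    proof (rule c_lift[OF sig_sorts(2)[OF \<sigma>] W])
      show "g \<in> FO U ?W \<rightarrow> Z (Out \<Sigma> \<sigma>)"
        unfolding FO_W using tm[OF \<sigma>] g by (auto simp: Z_def tuples_def elim!: set_prodE)
      fix B \<rho> assume B: "ok B \<rho>"
      then have B': "B \<in> algs"
        by (simp add: ok_def)
      let ?hs = "map (\<lambda>i w. ev B \<rho> (tup_nth \<U> i w)) [0..<?n]"
      have "adm (prodO \<U> V U (map c ?Ss)) (prodO \<U> V U (map (Carr B) ?Ss)) (\<lambda>w. tup \<U> (map (\<lambda>h. h w) ?hs))"
      proof (rule adm_prodI[OF Carrs_ob[OF B' sig_sorts(1)[OF \<sigma>]] prodO_ob[OF cs]])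
        fix i assume "i < length (map (Carr B) ?Ss)"
        then have i: "i < ?n"
          by simp
        then have S: "?Ss ! i \<in> \<S>"
          using sig_sorts(1)[OF \<sigma>] nth_mem by blast
        have "adm (prodO \<U> V U (map c ?Ss)) (c (?Ss ! i)) (tup_nth \<U> i)"
          using adm_prodP[OF cs, of i] i by simp
        from adm_comp[OF this c_ev[OF S B]]
        show "adm (prodO \<U> V U (map c ?Ss)) (map (Carr B) ?Ss ! i) (?hs ! i)"
          using i by simp
      qed simp
      note adm = adm_comp[OF adm_ten[OF adm_id[OF Par_ob[OF \<sigma>]] this] adm_hom[OF Intp_hom[OF B' \<sigma>]]]
      show "adm ?W (Carr B (Out \<Sigma> \<sigma>)) (\<lambda>x. ev B \<rho> (g x))"
      proof (rule adm_cong[OF adm])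
        fix z assume "z \<in> FO U ?W"
        then obtain p xs where z: "z = enc \<U> (p, tup \<U> xs)" "p \<in> FO U (Par \<Sigma> \<sigma>)" "xs \<in> listset (map Z ?Ss)"
          unfolding FO_W by (auto simp: tuples_def elim!: set_prodE)
        have "map (\<lambda>h. h (tup \<U> xs)) ?hs = map (ev B \<rho>) xs"
          using z(3) by (auto simp: in_listset_conv_nth intro: nth_equalityI)
        then show "act (Intp B \<sigma>) (enc \<U> (map_prod (\<lambda>x. x) (\<lambda>w. tup \<U> (map (\<lambda>h. h w) ?hs)) (dec \<U> z))) =
            ev B \<rho> (g z)"
          unfolding z(1) g[OF z(3)] ev_App[OF \<sigma> z(2,3) B] by (simp del: map_map)
      qed
    qed
    then obtain m where "m \<in> hom V ?W (c (Out \<Sigma> \<sigma>))" "\<And>z. z \<in> FO U ?W \<Longrightarrow> act m z = g z"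
      by (auto simp: adm_def)
    then have "is_op \<sigma> m"
      using g by (simp add: is_op_def FO_W)
    then show ?thesis ..
  qed
  then obtain m where is_op: "\<And>\<sigma>. \<sigma> \<in> Ops \<Sigma> \<Longrightarrow> is_op \<sigma> (m \<sigma>)"
    by metis
  have m: "\<And>\<sigma>. \<sigma> \<in> Ops \<Sigma> \<Longrightarrow>
      m \<sigma> \<in> hom V (Par \<Sigma> \<sigma> \<otimes>\<^bsub>V\<^esub> prodO \<U> V U (map c (Ins \<Sigma> \<sigma>))) (c (Out \<Sigma> \<sigma>))"
    "\<And>\<sigma> p xs. \<sigma> \<in> Ops \<Sigma> \<Longrightarrow> p \<in> FO U (Par \<Sigma> \<sigma>) \<Longrightarrow> xs \<in> listset (map Z (Ins \<Sigma> \<sigma>)) \<Longrightarrow>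
      act (m \<sigma>) (enc \<U> (p, tup \<U> xs)) = h (App (\<sigma>, p) (map d xs))"
    using is_op unfolding is_op_def by blast+
  define F :: "('op, 's, 'v, 'm) alg" where "F = \<lparr>Carr = restrict c \<S>, Intp = restrict m (Ops \<Sigma>)\<rparr>"
  have map_F: "map (restrict c \<S>) (Ins \<Sigma> \<sigma>) = map c (Ins \<Sigma> \<sigma>)"
    and args_F: "args F (Ins \<Sigma> \<sigma>) = listset (map Z (Ins \<Sigma> \<sigma>))" if "\<sigma> \<in> Ops \<Sigma>" for \<sigma>
    using sig_sorts(1)[OF that] c(2) by (auto simp: F_def intro!: arg_cong[of _ _ listset])
  have F: "F \<in> algs"
    unfolding algebras_def using c(1) m(1) sig_sorts(2) by (auto simp: F_def map_F)
  show ?thesis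
  proof
    show "F \<in> algs"
      by (rule F)
    show FO_F: "FO U (Carr F S) = h ` {t. ?tm t S}" if "S \<in> \<S>" for S
      using that c(2) by (simp add: F_def Z_def)
    fix B \<rho> assume B: "B \<in> algs" and \<rho>: "\<And>v. v \<in> set vs \<Longrightarrow> \<rho> v \<in> FO U (Carr B (fst v))"
    then have ok: "ok B \<rho>"
      by (simp add: ok_def)
    \<comment> \<open>Evaluation in \<open>B\<close> under \<rho> is itself a leg of the source,
      hence underlies a morphism.\<close>
    have "\<exists>f\<in>hom V (c S) (Carr B S). \<forall>z\<in>Z S. act f z = ev B \<rho> z" if "S \<in> \<S>" for S
      using c_ev[OF that ok] c(2)[OF that] by (simp add: adm_def)
    then obtain f where f: "\<And>S. S \<in> \<S> \<Longrightarrow> f S \<in> hom V (c S) (Carr B S)"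
      "\<And>S z. S \<in> \<S> \<Longrightarrow> z \<in> Z S \<Longrightarrow> act (f S) z = ev B \<rho> z"
      by metis
    have "act (restrict f \<S> (Out \<Sigma> \<sigma>)) (opn F \<sigma> p xs) =
        opn B \<sigma> p (map2 (\<lambda>S. act (restrict f \<S> S)) (Ins \<Sigma> \<sigma>) xs)"
      if \<sigma>: "\<sigma> \<in> Ops \<Sigma>" and p: "p \<in> FO U (Par \<Sigma> \<sigma>)" and xs: "xs \<in> args F (Ins \<Sigma> \<sigma>)" for \<sigma> p xs
    proof -
      have xs': "xs \<in> listset (map Z (Ins \<Sigma> \<sigma>))"
        using xs args_F[OF \<sigma>] by simp
      have op: "opn F \<sigma> p xs = h (App (\<sigma>, p) (map d xs))"
        using m(2)[OF \<sigma> p xs'] \<sigma> by (simp add: F_def)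
      have in_Z: "opn F \<sigma> p xs \<in> Z (Out \<Sigma> \<sigma>)"
        using opn_in[OF F \<sigma> p xs] FO_F[OF sig_sorts(2)[OF \<sigma>]] by (simp add: Z_def)
      have "map2 (\<lambda>S. act (restrict f \<S> S)) (Ins \<Sigma> \<sigma>) xs = map (ev B \<rho>) xs"
        using xs' f(2) sig_sorts(1)[OF \<sigma>] by (auto simp: in_listset_conv_nth subset_iff intro!: nth_equalityI)
      then show ?thesis
        using f(2)[OF sig_sorts(2)[OF \<sigma>] in_Z] sig_sorts(2)[OF \<sigma>] ev_App[OF \<sigma> p xs' ok] op by simp
    qed
    then have "(F, restrict f \<S>, B) \<in> alg_arrs \<U> V U \<S> \<Sigma>"
      unfolding alg_arr_iff using F B f(1) by (auto simp: F_def)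
    moreover have "act (restrict f \<S> S) (h t) = eval_term (und B) \<rho> t" if "?tm t S" for S t
      using f(2)[of S "h t"] that term_in_context_sort[OF that vs'] by (auto simp: ev_def Z_def)
    ultimately show "\<exists>f. (F, f, B) \<in> alg_arrs \<U> V U \<S> \<Sigma> \<and>
        (\<forall>S t. ?tm t S \<longrightarrow> act (f S) (h t) = eval_term (und B) \<rho> t)"
      by blast
  qed
qed

text \<open>A Yoneda argument: each \<open>xs\<close> is the image of the tuple of variables under a
  homomorphism out of \<open>F\<close>, and naturality along it carries the value of \<omega> from
  \<open>F\<close> to \<open>B\<close>. One term thus serves all algebras.\<close>

lemma algebraic_operation_term:
  assumes \<omega>: "algebraic_operation \<U> V U \<S> \<Sigma> Ss S P \<omega>" and p: "p \<in> FO U P"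
    and vs: "is_context \<S> vs" "map fst vs = Ss"
  shows "\<exists>t. term_in_context (und_sig U \<Sigma>) vs t S \<and>
    (\<forall>B\<in>algs. \<forall>xs\<in>args B Ss. act (\<omega> B) (enc \<U> (p, tup \<U> xs)) = eval_term (und B) (val vs xs) t)"
proof -
  have sorts: "set Ss \<subseteq> \<S>" "S \<in> \<S>" "P \<in> Ob V"
    and nat: "nat_trans (Alg_cat \<U> V U \<S> \<Sigma>) V (param_power \<U> V U P Ss) (carrier_at S) \<omega>"
    using \<omega> by (auto simp: algebraic_operation_def)
  have hom: "\<omega> B \<in> hom V (args_ob P B Ss) (Carr B S)" if "B \<in> algs" for B
    using nat_trans.component[OF nat, of B] that by simp
  obtain F h where F: "F \<in> algs"
    and FO_F: "\<And>S. S \<in> \<S> \<Longrightarrow> FO U (Carr F S) = h ` {t. term_in_context (und_sig U \<Sigma>) vs t S}"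
    and ext: "\<And>B \<rho>. B \<in> algs \<Longrightarrow> (\<And>v. v \<in> set vs \<Longrightarrow> \<rho> v \<in> FO U (Carr B (fst v))) \<Longrightarrow>
      \<exists>f. (F, f, B) \<in> alg_arrs \<U> V U \<S> \<Sigma> \<and>
        (\<forall>S t. term_in_context (und_sig U \<Sigma>) vs t S \<longrightarrow> act (f S) (h t) = eval_term (und B) \<rho> t)"
    using free_algebra[OF vs(1)] by blast
  \<comment> \<open>The generic argument list, made of the variables as elements of
    \<open>F\<close>.\<close>
  let ?gs = "map (\<lambda>v. h (Var v)) vs"
  have var: "term_in_context (und_sig U \<Sigma>) vs (Var v) (fst v)" if "v \<in> set vs" for v
    using that by (rule term_in_context.intros)
  have "h (Var v) \<in> FO U (Carr F (fst v))" if "v \<in> set vs" for v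
  proof -
    have "fst v \<in> \<S>"
      using that sorts(1) unfolding vs(2)[symmetric] by (simp add: image_subset_iff)
    then show ?thesis
      using var[OF that] by (simp add: FO_F)
  qed
  then have gs: "?gs \<in> args F Ss"
    by (auto simp: vs(2)[symmetric] in_listset_conv_nth)
  have z: "enc \<U> (p, tup \<U> ?gs) \<in> FO U (args_ob P F Ss)"
    using p gs FO_args_ob[OF F sorts(1,3)] by force
  then have "act (\<omega> F) (enc \<U> (p, tup \<U> ?gs)) \<in> FO U (Carr F S)"
    by (rule act_in[OF hom[OF F]])
  then obtain t where t: "term_in_context (und_sig U \<Sigma>) vs t S"
    "act (\<omega> F) (enc \<U> (p, tup \<U> ?gs)) = h t"
    using FO_F[OF sorts(2)] by auto
  have "act (\<omega> B) (enc \<U> (p, tup \<U> xs)) = eval_term (und B) (val vs xs) t"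
    if B: "B \<in> algs" and xs: "xs \<in> args B Ss" for B xs
  proof -
    have dist: "distinct vs"
      using vs(1) by (simp add: is_context_def)
    have "val vs xs v \<in> FO U (Carr B (fst v))" if "v \<in> set vs" for v
      using val_in[OF dist _ that] xs vs(2) by simp
    then obtain f where f: "(F, f, B) \<in> alg_arrs \<U> V U \<S> \<Sigma>"
      "\<And>S t. term_in_context (und_sig U \<Sigma>) vs t S \<Longrightarrow> act (f S) (h t) = eval_term (und B) (val vs xs) t"
      using ext[OF B, of "val vs xs"] by blast
    have fS: "f S \<in> hom V (Carr F S) (Carr B S)" if "S \<in> set Ss" for S
      using alg_arrD(4)[OF f(1)] that sorts(1) by blast
    note pm = args_map_hom[OF F sorts(1,3) fS]
    have len: "length xs = length vs"
      using xs vs(2) by (auto simp: in_listset_conv_nth)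
    have "act (f (fst (vs ! i))) (h (Var (vs ! i))) = xs ! i" if "i < length vs" for i
      using f(2)[OF var[OF nth_mem[OF that]]] val_nth[OF dist len that] by simp
    then have "map2 (\<lambda>S. act (f S)) Ss ?gs = xs"
      using len by (auto simp: vs(2)[symmetric] intro!: nth_equalityI)
    then have "act (\<omega> B) (enc \<U> (p, tup \<U> xs)) =
        act (Cmp V (\<omega> B) (Idn V P \<boxtimes>\<^bsub>V\<^esub> prodA \<U> V U (map f Ss))) (enc \<U> (p, tup \<U> ?gs))"
      using act_comp[OF pm hom[OF B] z] act_args_map[OF F sorts(1,3) fS p gs] by simp
    \<comment> \<open>Naturality at the homomorphism that sends the generic list to
      \<open>xs\<close>.\<close>
    also have "Cmp V (\<omega> B) (Idn V P \<boxtimes>\<^bsub>V\<^esub> prodA \<U> V U (map f Ss)) = Cmp V (f S) (\<omega> F)"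
      using nat_trans.naturality[OF nat, of "(F, f, B)" F B] f(1) by (simp add: hom_Alg)
    also have "act (Cmp V (f S) (\<omega> F)) (enc \<U> (p, tup \<U> ?gs)) = act (f S) (h t)"
      using act_comp[OF hom[OF F] alg_arrD(4)[OF f(1) sorts(2)] z] t(2) by simp
    also have "\<dots> = eval_term (und B) (val vs xs) t"
      by (rule f(2)[OF t(1)])
    finally show ?thesis .
  qed
  then show ?thesis
    using t(1) by blast
qed

text \<open>An enriched equation splits into one classical equation for each point of its parameter
  object; that these points form a small set keeps the resulting theory small.\<close>

lemma enriched_to_classical:
  assumes E: "enriched_theory \<U> V U \<S> \<Sigma> E"
  shows "\<exists>E'. classical_theory \<U> \<S> (und_sig U \<Sigma>) E' \<and>
    (\<forall>A\<in>algs. A \<in> theory_algebras \<U> V U \<S> \<Sigma> E \<longleftrightarrow>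
       und A \<in> classical_theory_algebras \<U> \<S> (und_sig U \<Sigma>) E')"
proof -
  \<comment> \<open>Numbering by position keeps the variables distinct even when an input sort is
    repeated.\<close>
  define ctx where "ctx e = zip (eqIns e) [0..<length (eqIns e)]" for e :: "('op, 's, 'v, 'm) alg_eqn"
  define trm where "trm e \<omega> p = (SOME t. term_in_context (und_sig U \<Sigma>) (ctx e) t (eqOut e) \<and>
    (\<forall>B\<in>algs. \<forall>xs\<in>args B (eqIns e).
       act (\<omega> B) (enc \<U> (p, tup \<U> xs)) = eval_term (und B) (val (ctx e) xs) t))"
    for e \<omega> p
  have e: "algebraic_operation \<U> V U \<S> \<Sigma> (eqIns e) (eqOut e) (eqPar e) (eqL e)"
    "algebraic_operation \<U> V U \<S> \<Sigma> (eqIns e) (eqOut e) (eqPar e) (eqR e)" if "e \<in> E" for e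
    using E that by (auto simp: enriched_theory_def)
  then have sorts: "set (eqIns e) \<subseteq> \<S>" "eqPar e \<in> Ob V" if "e \<in> E" for e
    using that by (auto simp: algebraic_operation_def)
  have ctx_fst: "map fst (ctx e) = eqIns e" for e
    by (simp add: ctx_def)
  then have ctx: "is_context \<S> (ctx e)" "fst ` set (ctx e) \<subseteq> \<S>" if "e \<in> E" for e
    using sorts(1)[OF that] by (auto simp: is_context_def ctx_def distinct_zipI2 dest: set_zip_leftD)
  have trm: "term_in_context (und_sig U \<Sigma>) (ctx e) (trm e \<omega> p) (eqOut e)"
    "\<And>B xs. B \<in> algs \<Longrightarrow> xs \<in> args B (eqIns e) \<Longrightarrow>
       act (\<omega> B) (enc \<U> (p, tup \<U> xs)) = eval_term (und B) (val (ctx e) xs) (trm e \<omega> p)"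
    if "e \<in> E" "p \<in> FO U (eqPar e)" "algebraic_operation \<U> V U \<S> \<Sigma> (eqIns e) (eqOut e) (eqPar e) \<omega>" for e p \<omega>
    using someI_ex[OF algebraic_operation_term[OF that(3,2) ctx(1)[OF that(1)] ctx_fst], folded trm_def] by auto
  let ?I = "SIGMA e : E. FO U (eqPar e)"
  let ?q = "\<lambda>(e, p). \<lparr>ctxt = ctx e, srt = eqOut e, lhs = trm e (eqL e) p, rhs = trm e (eqR e) p\<rparr>"
  have "is_small \<U> ?I"
    using E sorts(2) FO_small by (auto simp: enriched_theory_def is_small_iff intro!: is_small_Sigma)
  then have "classical_theory \<U> \<S> (und_sig U \<Sigma>) (?q ` ?I)"
    using ctx(1) trm(1) e classical_signature_und_sig
    by (auto simp: classical_theory_def intro!: is_small_image)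
  moreover have "A \<in> theory_algebras \<U> V U \<S> \<Sigma> E \<longleftrightarrow>
      und A \<in> classical_theory_algebras \<U> \<S> (und_sig U \<Sigma>) (?q ` ?I)" if A: "A \<in> algs" for A
  proof -
    have "eqL e A = eqR e A \<longleftrightarrow> (\<forall>p\<in>FO U (eqPar e).
        interp_term (und A) (ctx e) (trm e (eqL e) p) = interp_term (und A) (ctx e) (trm e (eqR e) p))"
      if "e \<in> E" for e
    proof -
      have hom: "\<omega> A \<in> hom V (args_ob (eqPar e) A (eqIns e)) (Carr A (eqOut e))"
        if "algebraic_operation \<U> V U \<S> \<Sigma> (eqIns e) (eqOut e) (eqPar e) \<omega>" for \<omega>
        using that A by (auto simp: algebraic_operation_def dest: nat_trans.component)
      \<comment> \<open>Equality at \<open>A\<close> is tested for every parameter and argument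
        list; fixing the parameter leaves the comparison of two term functions.\<close>
      have "eqL e A = eqR e A \<longleftrightarrow> (\<forall>p\<in>FO U (eqPar e). \<forall>xs\<in>args A (eqIns e).
          act (eqL e A) (enc \<U> (p, tup \<U> xs)) = act (eqR e A) (enc \<U> (p, tup \<U> xs)))"
        using args_ob_eqI[OF A sorts[OF that] hom[OF e(1)[OF that]] hom[OF e(2)[OF that]]] by auto
      then show ?thesis
        using trm(2)[OF that _ e(1)[OF that] A] trm(2)[OF that _ e(2)[OF that] A]
        by (simp add: interp_term_eq_iff[OF ctx(2)[OF that]] ctx_fst)
    qed
    then show ?thesis
      using A und_in_classical_algebras[OF A] by (auto simp: theory_algebras_def classical_theory_algebras_def)
  qed
  ultimately show ?thesis
    by blast
qed

end

theorem theorem4p1p17: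
  fixes \<U> :: "'u universe"
    and V :: "('v, 'm) smcat"
    and U :: "('v, 'm, 'u set, 'u set_arr) fctr"
    and \<S> :: "'s set"
  assumes "set_universe \<U>"
    and "symmetric_monoidal_category V"
    and "topological_functor V (Set_cat \<U>) U"
    and "strict_symmetric_monoidal_functor V (Set_cat \<U>) U"
    and "is_small \<U> \<S>"
  shows "(\<forall>(\<Sigma> :: ('op, 's, 'v) esig) E. enriched_theory \<U> V U \<S> \<Sigma> E \<longrightarrow>
            (\<exists>E'. classical_theory \<U> \<S> (und_sig U \<Sigma>) E' \<and>
               (\<forall>A \<in> algebras \<U> V U \<S> \<Sigma>.
                  A \<in> theory_algebras \<U> V U \<S> \<Sigma> E \<longleftrightarrow>
                  und_alg \<U> U \<S> \<Sigma> A \<in> classical_theory_algebras \<U> \<S> (und_sig U \<Sigma>) E')))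
       \<and> (\<forall>(\<Sigma> :: ('op, 's, 'v) esig) E. enriched_signature \<U> V \<S> \<Sigma> \<longrightarrow>
            classical_theory \<U> \<S> (und_sig U \<Sigma>) E \<longrightarrow>
            (\<exists>E'. enriched_theory \<U> V U \<S> \<Sigma> E' \<and>
               (\<forall>A \<in> algebras \<U> V U \<S> \<Sigma>.
                  A \<in> theory_algebras \<U> V U \<S> \<Sigma> E' \<longleftrightarrow>
                  und_alg \<U> U \<S> \<Sigma> A \<in> classical_theory_algebras \<U> \<S> (und_sig U \<Sigma>) E)))"
proof -
  have setting: "enriched_setting \<U> V U \<S> \<Sigma>" if "enriched_signature \<U> V \<S> \<Sigma>"
    for \<Sigma> :: "('op, 's, 'v) esig"
    using assms that
    by (intro enriched_setting.intro topological_setting.intro enriched_setting_axioms.intro)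
  have sig: "enriched_signature \<U> V \<S> \<Sigma>" if "enriched_theory \<U> V U \<S> \<Sigma> E"
    for \<Sigma> :: "('op, 's, 'v) esig" and E
    using that by (simp add: enriched_theory_def)
  show ?thesis
    by (intro conjI allI impI enriched_setting.enriched_to_classical[OF setting[OF sig]]
        enriched_setting.classical_to_enriched[OF setting])
qed

end
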